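(* Let $M$ be a compact $C^\infty$ manifold without boundary of dimension $n\ge 3$ with a $C^\infty$ volume form $\omega$. Let $X\in\mathcal{X}^\infty_\omega(M)$, let $a\in M$ be a regular point of $X$, and let $\Sigma$ be a transversal section to $X$ which contains $a$. Then there exists a $C^\infty$ coordinate system $\alpha:U\subset M\to V\subset\mathbb{R}^n$, defined on a neighborhood $U$ of $a$, with $\alpha(a)=0$ and such that: 1. $\alpha_*X\equiv(0,\dots,0,1)$; 2. $\alpha_*\omega=dx_1\wedge\cdots\wedge dx_n$; 3. $\alpha(U\cap\Sigma)\subset\{x_n=0\}$.
   Context: $\mathcal{X}^\infty_\omega(M)$ is the set of $C^\infty$ vector fields on $M$ whose flow preserves $\omega$. A regular point of $X$ is a point $a$ with $X(a)\neq 0$. A transversal section to $X$ is a $C^\infty$ embedded codimension-one submanifold without boundary of $M$ transversal to $X$. $\alpha_*$ denotes push-forward by the diffeomorphism $\alpha$, and $x_1,\dots,x_n$ are the standard coordinates of $\mathbb{R}^n$. *)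

theory Defs
  imports "HOL-Analysis.Analysis"
begin

section \<open>Smooth maps between Euclidean spaces\<close>

text \<open>Both predicates are meant for open \<open>S\<close>.  In finite dimension, \<open>f\<close> is of class
  \<open>C\<^sup>k\<^sup>+\<^sup>1\<close> iff it is differentiable and all its directional derivatives are of class \<open>C\<^sup>k\<close>.\<close>

primrec ck_on :: "nat \<Rightarrow> 'a::euclidean_space set \<Rightarrow> ('a \<Rightarrow> 'b::euclidean_space) \<Rightarrow> bool" where
  "ck_on 0 S f \<longleftrightarrow> continuous_on S f"
| "ck_on (Suc k) S f \<longleftrightarrow> (\<forall>x\<in>S. f differentiable (at x)) \<and>
     (\<forall>v. ck_on k S (\<lambda>x. frechet_derivative f (at x) v))"

definition smooth_on :: "'a::euclidean_space set \<Rightarrow> ('a \<Rightarrow> 'b::euclidean_space) \<Rightarrow> bool" where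
  "smooth_on S f \<longleftrightarrow> (\<forall>k. ck_on k S f)"


section \<open>Smooth manifolds\<close>

text \<open>A chart is a pair of its domain and its coordinate map; the values of the map outside
  the domain are irrelevant.  The dimension of the manifold is \<open>CARD('n)\<close>.\<close>

type_synonym ('a, 'n) chart = "'a set \<times> ('a \<Rightarrow> real ^ 'n)"

record ('a, 'n) manifold =
  Top :: "'a topology"
  Atlas :: "('a, 'n) chart set"

definition is_chart :: "('a, 'n::finite) manifold \<Rightarrow> ('a, 'n) chart \<Rightarrow> bool" where
  "is_chart M c \<longleftrightarrow> openin (Top M) (fst c) \<and> open (snd c ` fst c) \<and>
     homeomorphic_map (subtopology (Top M) (fst c)) (top_of_set (snd c ` fst c)) (snd c)"

definition chart_inv :: "('a, 'n::finite) chart \<Rightarrow> real ^ 'n \<Rightarrow> 'a" where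
  "chart_inv c = inv_into (fst c) (snd c)"

definition transition ::
    "('a, 'n::finite) chart \<Rightarrow> ('a, 'n) chart \<Rightarrow> real ^ 'n \<Rightarrow> real ^ 'n" where
  "transition c d = snd d \<circ> chart_inv c"

definition compatible :: "('a, 'n::finite) chart \<Rightarrow> ('a, 'n) chart \<Rightarrow> bool" where
  "compatible c d \<longleftrightarrow> smooth_on (snd c ` (fst c \<inter> fst d)) (transition c d) \<and>
     smooth_on (snd d ` (fst c \<inter> fst d)) (transition d c)"

definition smooth_manifold :: "('a, 'n::finite) manifold \<Rightarrow> bool" where
  "smooth_manifold M \<longleftrightarrow> Hausdorff_space (Top M) \<and> second_countable (Top M) \<and>
     (\<forall>c\<in>Atlas M. is_chart M c) \<and> (\<Union>c\<in>Atlas M. fst c) = topspace (Top M) \<and>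
     (\<forall>c\<in>Atlas M. \<forall>d\<in>Atlas M. compatible c d)"

text \<open>The maximal atlas, i.e. all smooth coordinate systems of \<open>M\<close>.\<close>

definition smooth_charts :: "('a, 'n::finite) manifold \<Rightarrow> ('a, 'n) chart set" where
  "smooth_charts M = {c. is_chart M c \<and> (\<forall>d\<in>Atlas M. compatible c d)}"

definition charts_at :: "('a, 'n::finite) manifold \<Rightarrow> 'a \<Rightarrow> ('a, 'n) chart set" where
  "charts_at M p = {c \<in> smooth_charts M. p \<in> fst c}"


section \<open>Tangent vectors\<close>

text \<open>A tangent vector at \<open>p\<close> is a family of coordinate vectors, one for each smooth chart
  around \<open>p\<close>, related by the derivatives of the transition maps.  The value \<open>0\<close> at all
  other arguments makes the representation unique; vector space operations are pointwise.\<close>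

type_synonym ('a, 'n) tangent = "('a, 'n) chart \<Rightarrow> real ^ 'n"

definition tangent_space ::
    "('a, 'n::finite) manifold \<Rightarrow> 'a \<Rightarrow> ('a, 'n) tangent set" where
  "tangent_space M p = {v.
     (\<forall>c\<in>charts_at M p. \<forall>d\<in>charts_at M p.
        v d = frechet_derivative (transition c d) (at (snd c p)) (v c)) \<and>
     (\<forall>c. c \<notin> charts_at M p \<longrightarrow> v c = 0)}"

text \<open>The differential of the inverse of the chart \<open>c\<close> at \<open>y\<close>, applied to \<open>u\<close>.\<close>

definition chart_inv_diff ::
    "('a, 'n::finite) manifold \<Rightarrow> ('a, 'n) chart \<Rightarrow> real ^ 'n \<Rightarrow> real ^ 'n \<Rightarrow> ('a, 'n) tangent" where
  "chart_inv_diff M c y u = (\<lambda>d. if d \<in> charts_at M (chart_inv c y)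
     then frechet_derivative (transition c d) (at y) u else 0)"

text \<open>The differential at \<open>p\<close> of a smooth map \<open>F\<close> from \<open>M\<close> to itself; by the chain rule it
  does not depend on the auxiliary chart around \<open>p\<close>.\<close>

definition differential ::
    "('a, 'n::finite) manifold \<Rightarrow> ('a \<Rightarrow> 'a) \<Rightarrow> 'a \<Rightarrow> ('a, 'n) tangent \<Rightarrow> ('a, 'n) tangent" where
  "differential M F p v =
     (let c = (SOME c. c \<in> charts_at M p) in
      (\<lambda>d. if d \<in> charts_at M (F p)
          then frechet_derivative (snd d \<circ> F \<circ> chart_inv c) (at (snd c p)) (v c) else 0))"

definition velocity ::
    "('a, 'n::finite) manifold \<Rightarrow> (real \<Rightarrow> 'a) \<Rightarrow> real \<Rightarrow> ('a, 'n) tangent" where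
  "velocity M \<gamma> t = (\<lambda>d. if d \<in> charts_at M (\<gamma> t)
     then vector_derivative (snd d \<circ> \<gamma>) (at t) else 0)"

definition smooth_curve ::
    "('a, 'n::finite) manifold \<Rightarrow> real set \<Rightarrow> (real \<Rightarrow> 'a) \<Rightarrow> bool" where
  "smooth_curve M I \<gamma> \<longleftrightarrow> continuous_map (top_of_set I) (Top M) \<gamma> \<and>
     (\<forall>d\<in>smooth_charts M. smooth_on {t \<in> I. \<gamma> t \<in> fst d} (snd d \<circ> \<gamma>))"


section \<open>Vector fields and flows\<close>

text \<open>The push-forward of a vector field by a chart: the differential of \<open>c\<close> sends a tangent
  vector to its representative with respect to \<open>c\<close>.\<close>

definition push_field ::
    "('a, 'n::finite) chart \<Rightarrow> ('a \<Rightarrow> ('a, 'n) tangent) \<Rightarrow> real ^ 'n \<Rightarrow> real ^ 'n" where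
  "push_field c X y = X (chart_inv c y) c"

definition smooth_field ::
    "('a, 'n::finite) manifold \<Rightarrow> ('a \<Rightarrow> ('a, 'n) tangent) \<Rightarrow> bool" where
  "smooth_field M X \<longleftrightarrow> (\<forall>p\<in>topspace (Top M). X p \<in> tangent_space M p) \<and>
     (\<forall>c\<in>smooth_charts M. smooth_on (snd c ` fst c) (push_field c X))"

definition regular_point ::
    "('a, 'n::finite) manifold \<Rightarrow> ('a \<Rightarrow> ('a, 'n) tangent) \<Rightarrow> 'a \<Rightarrow> bool" where
  "regular_point M X p \<longleftrightarrow> p \<in> topspace (Top M) \<and> X p \<noteq> (\<lambda>_. 0)"

text \<open>\<open>\<phi>\<close> is the flow of \<open>X\<close>: the smooth one-parameter group of diffeomorphisms of \<open>M\<close> whose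
  orbits are the integral curves of \<open>X\<close>.  On a compact manifold every smooth vector field has
  exactly one such flow (up to the irrelevant values outside \<open>M\<close>).\<close>

definition flow_of ::
    "('a, 'n::finite) manifold \<Rightarrow> ('a \<Rightarrow> ('a, 'n) tangent) \<Rightarrow> (real \<Rightarrow> 'a \<Rightarrow> 'a) \<Rightarrow> bool" where
  "flow_of M X \<phi> \<longleftrightarrow>
     continuous_map (prod_topology euclidean (Top M)) (Top M) (\<lambda>(t, p). \<phi> t p) \<and>
     (\<forall>c\<in>smooth_charts M. \<forall>d\<in>smooth_charts M.
        smooth_on {(t, y). y \<in> snd c ` fst c \<and> \<phi> t (chart_inv c y) \<in> fst d}
          (\<lambda>(t, y). snd d (\<phi> t (chart_inv c y)))) \<and>
     (\<forall>p\<in>topspace (Top M). \<phi> 0 p = p) \<and>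
     (\<forall>s t. \<forall>p\<in>topspace (Top M). \<phi> (s + t) p = \<phi> s (\<phi> t p)) \<and>
     (\<forall>t. \<forall>p\<in>topspace (Top M). velocity M (\<lambda>s. \<phi> s p) t = X (\<phi> t p))"


section \<open>Volume forms\<close>

text \<open>A form of top degree takes a family of tangent vectors indexed by \<open>'n\<close>; its \<open>k\<close>-th argument
  is the one at the \<open>k\<close>-th smallest index.\<close>

type_synonym ('a, 'n) top_form = "'a \<Rightarrow> ('n \<Rightarrow> ('a, 'n) tangent) \<Rightarrow> real"

definition alternating_form_at ::
    "('a, 'n::finite) manifold \<Rightarrow> 'a \<Rightarrow> (('n \<Rightarrow> ('a, 'n) tangent) \<Rightarrow> real) \<Rightarrow> bool" where
  "alternating_form_at M p \<eta> \<longleftrightarrow> (\<forall>v. (\<forall>i. v i \<in> tangent_space M p) \<longrightarrow>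
     (\<forall>i. \<forall>x\<in>tangent_space M p. \<forall>y\<in>tangent_space M p. \<forall>r s.
        \<eta> (v(i := (\<lambda>c. r *\<^sub>R x c + s *\<^sub>R y c))) = r * \<eta> (v(i := x)) + s * \<eta> (v(i := y))) \<and>
     (\<forall>i j. i \<noteq> j \<and> v i = v j \<longrightarrow> \<eta> v = 0))"

definition push_form ::
    "('a, 'n::finite) manifold \<Rightarrow> ('a, 'n) chart \<Rightarrow> ('a, 'n) top_form \<Rightarrow>
     real ^ 'n \<Rightarrow> ('n \<Rightarrow> real ^ 'n) \<Rightarrow> real" where
  "push_form M c \<omega> y u = \<omega> (chart_inv c y) (\<lambda>i. chart_inv_diff M c y (u i))"

definition volume_form :: "('a, 'n::finite) manifold \<Rightarrow> ('a, 'n) top_form \<Rightarrow> bool" where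
  "volume_form M \<omega> \<longleftrightarrow>
     (\<forall>p\<in>topspace (Top M). alternating_form_at M p (\<omega> p) \<and>
        (\<exists>v. (\<forall>i. v i \<in> tangent_space M p) \<and> \<omega> p v \<noteq> 0)) \<and>
     (\<forall>c\<in>smooth_charts M. \<forall>u. smooth_on (snd c ` fst c) (\<lambda>y. push_form M c \<omega> y u))"

definition preserves_form ::
    "('a, 'n::finite) manifold \<Rightarrow> ('a \<Rightarrow> 'a) \<Rightarrow> ('a, 'n) top_form \<Rightarrow> bool" where
  "preserves_form M F \<omega> \<longleftrightarrow> (\<forall>p\<in>topspace (Top M). \<forall>v. (\<forall>i. v i \<in> tangent_space M p) \<longrightarrow>
     \<omega> (F p) (\<lambda>i. differential M F p (v i)) = \<omega> p v)"

definition volume_preserving_fields ::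
    "('a, 'n::finite) manifold \<Rightarrow> ('a, 'n) top_form \<Rightarrow> ('a \<Rightarrow> ('a, 'n) tangent) set" where
  "volume_preserving_fields M \<omega> =
     {X. smooth_field M X \<and> (\<exists>\<phi>. flow_of M X \<phi> \<and> (\<forall>t. preserves_form M (\<phi> t) \<omega>))}"

text \<open>The form \<open>dx\<^sub>1 \<and> \<dots> \<and> dx\<^sub>n\<close> on \<open>\<real>\<^sup>n\<close>, with the convention that it takes the value \<open>1\<close> on
  the standard basis.\<close>

definition std_volume :: "('n::finite \<Rightarrow> real ^ 'n) \<Rightarrow> real" where
  "std_volume u = det (\<chi> i j. u j $ i)"


section \<open>Transversal sections\<close>

text \<open>The index of the coordinate \<open>x\<^sub>n\<close>; the coordinates \<open>x\<^sub>1, \<dots>, x\<^sub>n\<close> are numbered by the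
  order of \<open>'n\<close>.\<close>

definition last_index :: "'n::{finite, linorder}" where
  "last_index = Max UNIV"

text \<open>Embedded submanifolds of codimension one without boundary (not necessarily closed subsets),
  by slice charts.\<close>

definition embedded_hypersurface ::
    "('a, 'n::{finite, linorder}) manifold \<Rightarrow> 'a set \<Rightarrow> bool" where
  "embedded_hypersurface M S \<longleftrightarrow> S \<subseteq> topspace (Top M) \<and>
     (\<forall>p\<in>S. \<exists>c\<in>charts_at M p.
        snd c ` (fst c \<inter> S) = {y \<in> snd c ` fst c. y $ last_index = 0})"

definition tangent_space_of_subset ::
    "('a, 'n::finite) manifold \<Rightarrow> 'a set \<Rightarrow> 'a \<Rightarrow> ('a, 'n) tangent set" where
  "tangent_space_of_subset M S p = {velocity M \<gamma> 0 | \<gamma> \<epsilon>. \<epsilon> > 0 \<and>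
     smooth_curve M {-\<epsilon><..<\<epsilon>} \<gamma> \<and> \<gamma> ` {-\<epsilon><..<\<epsilon>} \<subseteq> S \<and> \<gamma> 0 = p}"

definition transversal_section ::
    "('a, 'n::{finite, linorder}) manifold \<Rightarrow> ('a \<Rightarrow> ('a, 'n) tangent) \<Rightarrow> 'a set \<Rightarrow> bool" where
  "transversal_section M X S \<longleftrightarrow> embedded_hypersurface M S \<and>
     (\<forall>p\<in>S. \<forall>v\<in>tangent_space M p. \<exists>w\<in>tangent_space_of_subset M S p. \<exists>r.
        v = (\<lambda>c. w c + r *\<^sub>R X p c))"

end

theory Submission
  imports Defs
begin

text \<open>
  Transversality makes the flow of \<open>X\<close> a coordinate: every point near \<open>a\<close> is reached from a
  unique point of \<open>\<Sigma>\<close> in a unique small time.  Taking coordinates of that point on \<open>\<Sigma>\<close> together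
  with the time as last coordinate gives a smooth chart, by the inverse function theorem, in
  which the flow is translation along the last axis and the time vanishes on \<open>\<Sigma>\<close>
  (\<open>transversal_flow_box\<close>).

  Write the volume form in this chart as \<open>\<rho> dx\<^sub>1 \<and> \<dots> \<and> dx\<^sub>n\<close>.  The flow preserves the form and
  is a translation, so \<open>\<rho>\<close> does not depend on \<open>x\<^sub>n\<close> (\<open>push_form_translation_invariant\<close>); it has
  no zeros.  Choose \<open>k < n\<close> and replace the coordinate \<open>x\<^sub>k\<close> by the primitive of \<open>\<rho>\<close> with respect to
  \<open>x\<^sub>k\<close>.  This change of coordinates has Jacobian determinant \<open>\<rho>\<close>, which turns the density into
  \<open>1\<close>.  The primitive does not depend on \<open>x\<^sub>n\<close> either, so the field stays equal to the last basis
  vector, and the coordinate \<open>x\<^sub>n\<close> itself is not touched, so \<open>\<Sigma>\<close> stays in \<open>{x\<^sub>n = 0}\<close>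
  (\<open>straightened_chart_volume\<close>).

  The supporting material is a calculus for maps of class \<open>C\<^sup>k\<close>, with smoothness of local inverses
  (\<open>smooth_inverse_function\<close>) and of primitives depending on parameters
  (\<open>smooth_coord_primitive\<close>), the fact that a form of top degree is its value on the standard basis
  times the determinant (\<open>alternating_form_eq_std_volume\<close>), and the passage of tangent vectors
  and forms between charts.
\<close>

section \<open>Calculus of smooth maps\<close>

lemma ck_on_subset: "ck_on k S f \<Longrightarrow> T \<subseteq> S \<Longrightarrow> ck_on k T f"
  by (induction k arbitrary: f) (auto intro: continuous_on_subset)

lemma ck_on_continuous: "ck_on k S f \<Longrightarrow> continuous_on S f"
  by (cases k) (auto intro!: continuous_at_imp_continuous_on differentiable_imp_continuous_within)

lemma ck_on_Suc_D: "ck_on (Suc k) S f \<Longrightarrow> ck_on k S f"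
proof (induction k arbitrary: f)
  case 0
  then show ?case using ck_on_continuous[OF 0] by simp
qed auto

text \<open>The derivative at a point sees the values of a map in a neighbourhood, which is why maps
  that agree on \<open>S\<close> can be exchanged only for open \<open>S\<close>.\<close>

lemma ck_on_cong:
  assumes "open S" "\<And>x. x \<in> S \<Longrightarrow> f x = g x" "ck_on k S f"
  shows "ck_on k S g"
  using assms(2,3)
proof (induction k arbitrary: f g)
  case 0
  then show ?case by (simp cong: continuous_on_cong)
next
  case (Suc k)
  have der: "(g has_derivative frechet_derivative f (at x)) (at x)" if "x \<in> S" for x
  proof (rule has_derivative_transform_within_open[OF _ assms(1) that])
    show "(f has_derivative frechet_derivative f (at x)) (at x)"
      using Suc.prems(2) that by (simp add: frechet_derivative_works[symmetric])
  qed (use Suc.prems(1) in auto)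
  then have "frechet_derivative f (at x) = frechet_derivative g (at x)" if "x \<in> S" for x
    using frechet_derivative_at that by blast
  moreover have "ck_on k S (\<lambda>x. frechet_derivative f (at x) v)" for v
    using Suc.prems by simp
  ultimately have "ck_on k S (\<lambda>x. frechet_derivative g (at x) v)" for v
    using Suc.IH[of "\<lambda>x. frechet_derivative f (at x) v" "\<lambda>x. frechet_derivative g (at x) v"] by simp
  then show ?case using der by (auto simp: differentiable_def)
qed

text \<open>The predicate speaks about the derivative chosen by \<open>frechet_derivative\<close>; this rule accepts
  any formula for the derivative, so that the differentiation rules can be used as they stand.\<close>

lemma ck_on_Suc_derivI:
  assumes "open S" "\<And>x. x \<in> S \<Longrightarrow> (f has_derivative f' x) (at x)"
    and "\<And>v. ck_on k S (\<lambda>x. f' x v)"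
  shows "ck_on (Suc k) S f"
proof -
  have "f' x = frechet_derivative f (at x)" if "x \<in> S" for x
    using assms(2) frechet_derivative_at that by blast
  then have "ck_on k S (\<lambda>x. frechet_derivative f (at x) v)" for v
    using ck_on_cong[OF assms(1) _ assms(3)[of v]] by simp
  then show ?thesis using assms(2) by (auto simp: differentiable_def)
qed

lemma ck_on_local:
  assumes "\<And>x. x \<in> S \<Longrightarrow> \<exists>T. open T \<and> x \<in> T \<and> ck_on k (T \<inter> S) f" "open S"
  shows "ck_on k S f"
  using assms(1)
proof (induction k arbitrary: f)
  case 0
  have "continuous_on S f"
  proof (rule continuous_at_imp_continuous_on, rule ballI)
    fix x assume "x \<in> S"
    then obtain T where "open T" "x \<in> T" "continuous_on (T \<inter> S) f" using 0 by auto
    then show "isCont f x"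
      using \<open>x \<in> S\<close> assms(2) continuous_on_eq_continuous_at[of "T \<inter> S" f] by auto
  qed
  then show ?case by simp
next
  case (Suc k)
  have "f differentiable at x" if "x \<in> S" for x
    using Suc.prems[OF that] that by fastforce
  moreover have "ck_on k S (\<lambda>x. frechet_derivative f (at x) v)" for v
  proof (rule Suc.IH)
    fix x assume "x \<in> S"
    then obtain T where "open T" "x \<in> T" "ck_on (Suc k) (T \<inter> S) f" using Suc.prems by blast
    then show "\<exists>T. open T \<and> x \<in> T \<and> ck_on k (T \<inter> S) (\<lambda>x. frechet_derivative f (at x) v)"
      by auto
  qed
  ultimately show ?case by simp
qed

lemma ck_on_const: "ck_on k S (\<lambda>x. c)"
  by (induction k arbitrary: c) auto

lemma ck_on_bounded_linear:
  assumes "bounded_linear L"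
  shows "ck_on k S L"
proof -
  have "frechet_derivative L (at x) = L" for x
    using assms bounded_linear_imp_has_derivative frechet_derivative_at by metis
  then show ?thesis
    by (cases k) (auto simp: ck_on_const linear_continuous_on[OF assms]
        intro: bounded_linear_imp_differentiable[OF assms])
qed

lemma ck_on_compose_linear:
  assumes "open S" "bounded_linear L" "ck_on k S f"
  shows "ck_on k S (\<lambda>x. L (f x))"
  using assms(3)
proof (induction k arbitrary: f)
  case 0
  then show ?case using bounded_linear.continuous_on[OF assms(2)] by auto
next
  case (Suc k)
  show ?case
  proof (rule ck_on_Suc_derivI[OF assms(1), where f'="\<lambda>x v. L (frechet_derivative f (at x) v)"])
    show "((\<lambda>x. L (f x)) has_derivative (\<lambda>v. L (frechet_derivative f (at x) v))) (at x)"
      if "x \<in> S" for x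
      using Suc.prems that
      by (intro bounded_linear.has_derivative[OF assms(2)]) (auto simp: frechet_derivative_works[symmetric])
  qed (use Suc in auto)
qed

lemma ck_on_add:
  assumes "open S" "ck_on k S f" "ck_on k S g"
  shows "ck_on k S (\<lambda>x. f x + g x)"
  using assms(2,3)
proof (induction k arbitrary: f g)
  case 0
  then show ?case by (auto intro: continuous_intros)
next
  case (Suc k)
  show ?case
  proof (rule ck_on_Suc_derivI[OF assms(1), where
        f'="\<lambda>x v. frechet_derivative f (at x) v + frechet_derivative g (at x) v"])
    show "((\<lambda>x. f x + g x) has_derivative
        (\<lambda>v. frechet_derivative f (at x) v + frechet_derivative g (at x) v)) (at x)"
      if "x \<in> S" for x
      using Suc.prems that by (intro has_derivative_add) (auto simp: frechet_derivative_works[symmetric])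
  qed (use Suc in auto)
qed

lemma ck_on_sum:
  assumes "open S" "\<And>i. i \<in> I \<Longrightarrow> ck_on k S (f i)"
  shows "ck_on k S (\<lambda>x. \<Sum>i\<in>I. f i x)"
  using assms(2)
  by (induction I rule: infinite_finite_induct) (auto simp: ck_on_const intro!: ck_on_add assms(1))

lemma ck_on_scaleR:
  fixes f :: "'a::euclidean_space \<Rightarrow> real"
  assumes "open S" "ck_on k S f" "ck_on k S g"
  shows "ck_on k S (\<lambda>x. f x *\<^sub>R g x)"
  using assms(2,3)
proof (induction k arbitrary: f g)
  case 0
  then show ?case by (auto intro: continuous_intros)
next
  case (Suc k)
  show ?case
  proof (rule ck_on_Suc_derivI[OF assms(1), where
        f'="\<lambda>x v. f x *\<^sub>R frechet_derivative g (at x) v + frechet_derivative f (at x) v *\<^sub>R g x"])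
    show "((\<lambda>x. f x *\<^sub>R g x) has_derivative
        (\<lambda>v. f x *\<^sub>R frechet_derivative g (at x) v + frechet_derivative f (at x) v *\<^sub>R g x)) (at x)"
      if "x \<in> S" for x
      using Suc.prems that
      by (intro has_derivative_scaleR) (auto simp: frechet_derivative_works[symmetric])
    show "ck_on k S (\<lambda>x. f x *\<^sub>R frechet_derivative g (at x) v + frechet_derivative f (at x) v *\<^sub>R g x)" for v
      using Suc.prems ck_on_Suc_D[OF Suc.prems(1)] ck_on_Suc_D[OF Suc.prems(2)]
      by (intro ck_on_add[OF assms(1)] Suc.IH) auto
  qed
qed

lemma ck_on_mult:
  fixes f g :: "'a::euclidean_space \<Rightarrow> real"
  assumes "open S" "ck_on k S f" "ck_on k S g"
  shows "ck_on k S (\<lambda>x. f x * g x)"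
  using ck_on_scaleR[OF assms] by simp

lemma ck_on_prod:
  fixes f :: "'i \<Rightarrow> 'a::euclidean_space \<Rightarrow> real"
  assumes "open S" "\<And>i. i \<in> I \<Longrightarrow> ck_on k S (f i)"
  shows "ck_on k S (\<lambda>x. \<Prod>i\<in>I. f i x)"
  using assms(2)
  by (induction I rule: infinite_finite_induct) (auto simp: ck_on_const intro!: ck_on_mult assms(1))

lemma ck_on_inverse:
  fixes f :: "'a::euclidean_space \<Rightarrow> real"
  assumes "open S" "ck_on k S f" "\<And>x. x \<in> S \<Longrightarrow> f x \<noteq> 0"
  shows "ck_on k S (\<lambda>x. inverse (f x))"
  using assms(2)
proof (induction k)
  case 0
  then show ?case using assms(3) by (auto intro: continuous_intros)
next
  case (Suc k)
  show ?case
  proof (rule ck_on_Suc_derivI[OF assms(1), where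
        f'="\<lambda>x v. (- 1) * (inverse (f x) * frechet_derivative f (at x) v * inverse (f x))"])
    show "((\<lambda>x. inverse (f x)) has_derivative
        (\<lambda>v. (- 1) * (inverse (f x) * frechet_derivative f (at x) v * inverse (f x)))) (at x)"
      if "x \<in> S" for x
    proof -
      have "(f has_derivative frechet_derivative f (at x)) (at x)"
        using Suc.prems that frechet_derivative_works by auto
      from Deriv.has_derivative_inverse[OF assms(3)[OF that] this] show ?thesis by simp
    qed
    show "ck_on k S (\<lambda>x. (- 1) * (inverse (f x) * frechet_derivative f (at x) v * inverse (f x)))" for v
      using Suc ck_on_Suc_D[OF Suc.prems] by (intro ck_on_mult ck_on_const assms(1)) auto
  qed
qed

lemma ck_on_euclidean_iff:
  assumes "open S"
  shows "ck_on k S f \<longleftrightarrow> (\<forall>b\<in>Basis. ck_on k S (\<lambda>x. f x \<bullet> b))"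
proof
  assume "ck_on k S f"
  then show "\<forall>b\<in>Basis. ck_on k S (\<lambda>x. f x \<bullet> b)"
    using ck_on_compose_linear[OF assms bounded_linear_inner_left] by auto
next
  assume "\<forall>b\<in>Basis. ck_on k S (\<lambda>x. f x \<bullet> b)"
  then have "ck_on k S (\<lambda>x. \<Sum>b\<in>Basis. (f x \<bullet> b) *\<^sub>R b)"
    by (intro ck_on_sum ck_on_scaleR assms ck_on_const) auto
  then show "ck_on k S f" by (simp add: euclidean_representation)
qed

lemma ck_on_vec_iff:
  fixes f :: "'a::euclidean_space \<Rightarrow> real ^ 'n::finite"
  assumes "open S"
  shows "ck_on k S f \<longleftrightarrow> (\<forall>i. ck_on k S (\<lambda>x. f x $ i))"
proof -
  have B: "Basis = range (\<lambda>i. axis i 1 :: real ^ 'n)"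
    by (auto simp: Basis_vec_def)
  show ?thesis
    unfolding ck_on_euclidean_iff[OF assms, of k f] B by (simp add: inner_axis)
qed

text \<open>Induction on the order works because the chain rule, with the inner derivative expanded in a
  basis, involves the outer derivative only along finitely many fixed vectors: these are maps
  of order one less, composed with the inner map.\<close>

lemma ck_on_compose:
  fixes f :: "'a::euclidean_space \<Rightarrow> 'b::euclidean_space" and g :: "'b \<Rightarrow> 'c::euclidean_space"
  assumes "open S" "open T" "ck_on k S f" "ck_on k T g" "f ` S \<subseteq> T"
  shows "ck_on k S (\<lambda>x. g (f x))"
  using assms(3,4)
proof (induction k arbitrary: g)
  case 0
  then show ?case using assms(5) by (auto intro: continuous_on_compose2)
next
  case (Suc k)
  have lin: "linear (frechet_derivative g (at y))" if "y \<in> T" for y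
    using Suc.prems that by (auto intro: linear_frechet_derivative)
  show ?case
  proof (rule ck_on_Suc_derivI[OF assms(1), where
        f'="\<lambda>x v. \<Sum>b\<in>Basis. (frechet_derivative f (at x) v \<bullet> b) *\<^sub>R frechet_derivative g (at (f x)) b"])
    show "((\<lambda>x. g (f x)) has_derivative
        (\<lambda>v. \<Sum>b\<in>Basis. (frechet_derivative f (at x) v \<bullet> b) *\<^sub>R frechet_derivative g (at (f x)) b)) (at x)"
      if "x \<in> S" for x
    proof -
      have "f x \<in> T" using assms(5) that by auto
      have "((\<lambda>x. g (f x)) has_derivative
          (\<lambda>v. frechet_derivative g (at (f x)) (frechet_derivative f (at x) v))) (at x)"
        using Suc.prems that \<open>f x \<in> T\<close>
        by (intro has_derivative_compose[of f _ x UNIV g]) (auto simp: frechet_derivative_works[symmetric])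
      moreover have "frechet_derivative g (at (f x)) w =
          (\<Sum>b\<in>Basis. (w \<bullet> b) *\<^sub>R frechet_derivative g (at (f x)) b)" for w
      proof -
        have "frechet_derivative g (at (f x)) w =
            frechet_derivative g (at (f x)) (\<Sum>b\<in>Basis. (w \<bullet> b) *\<^sub>R b)"
          by (simp add: euclidean_representation)
        then show ?thesis
          using lin[OF \<open>f x \<in> T\<close>] by (simp add: linear_sum linear_cmul)
      qed
      then have "(\<lambda>v. frechet_derivative g (at (f x)) (frechet_derivative f (at x) v)) =
          (\<lambda>v. \<Sum>b\<in>Basis. (frechet_derivative f (at x) v \<bullet> b) *\<^sub>R frechet_derivative g (at (f x)) b)"
        by (rule ext)
      ultimately show ?thesis by (rule has_derivative_eq_rhs)
    qed
    have "ck_on k S (\<lambda>x. frechet_derivative g (at (f x)) b)" for b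
      using Suc.prems ck_on_Suc_D[OF Suc.prems(1)]
      by (intro Suc.IH[of "\<lambda>y. frechet_derivative g (at y) b"]) auto
    then show "ck_on k S (\<lambda>x. \<Sum>b\<in>Basis. (frechet_derivative f (at x) v \<bullet> b) *\<^sub>R
        frechet_derivative g (at (f x)) b)" for v
      using Suc.prems
      by (intro ck_on_sum ck_on_scaleR ck_on_compose_linear[OF assms(1) bounded_linear_inner_left] assms(1)) auto
  qed
qed

lemma ck_on_det:
  fixes A :: "'a::euclidean_space \<Rightarrow> real ^ 'n::finite ^ 'n"
  assumes "open S" "\<And>i j. ck_on k S (\<lambda>x. A x $ i $ j)"
  shows "ck_on k S (\<lambda>x. det (A x))"
  unfolding det_def
  by (intro ck_on_sum ck_on_mult ck_on_prod ck_on_const assms)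

lemma smooth_on_subset: "smooth_on S f \<Longrightarrow> T \<subseteq> S \<Longrightarrow> smooth_on T f"
  by (auto simp: smooth_on_def intro: ck_on_subset)

lemma smooth_on_cong:
  "open S \<Longrightarrow> (\<And>x. x \<in> S \<Longrightarrow> f x = g x) \<Longrightarrow> smooth_on S f \<Longrightarrow> smooth_on S g"
  unfolding smooth_on_def using ck_on_cong by blast

lemma smooth_on_compose:
  "open S \<Longrightarrow> open T \<Longrightarrow> smooth_on S f \<Longrightarrow> smooth_on T g \<Longrightarrow> f ` S \<subseteq> T \<Longrightarrow> smooth_on S (\<lambda>x. g (f x))"
  unfolding smooth_on_def using ck_on_compose by blast

lemma smooth_on_add: "open S \<Longrightarrow> smooth_on S f \<Longrightarrow> smooth_on S g \<Longrightarrow> smooth_on S (\<lambda>x. f x + g x)"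
  unfolding smooth_on_def using ck_on_add by blast

lemma smooth_on_const: "smooth_on S (\<lambda>x. c)"
  unfolding smooth_on_def using ck_on_const by blast

lemma smooth_on_bounded_linear: "bounded_linear L \<Longrightarrow> smooth_on S L"
  unfolding smooth_on_def using ck_on_bounded_linear by blast

lemma smooth_on_continuous: "smooth_on S f \<Longrightarrow> continuous_on S f"
  unfolding smooth_on_def using ck_on_continuous by blast

lemma smooth_on_local:
  assumes "\<And>x. x \<in> S \<Longrightarrow> \<exists>T. open T \<and> x \<in> T \<and> smooth_on (T \<inter> S) f" "open S"
  shows "smooth_on S f"
  unfolding smooth_on_def
proof
  show "ck_on k S f" for k
    by (rule ck_on_local[OF _ assms(2)]) (use assms(1) in \<open>force simp: smooth_on_def\<close>)
qed

lemma smooth_on_derivative: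
  "smooth_on S f \<Longrightarrow> x \<in> S \<Longrightarrow> (f has_derivative frechet_derivative f (at x)) (at x)"
  unfolding smooth_on_def using frechet_derivative_works ck_on.simps(2) by blast

lemma smooth_on_frechet_derivative:
  "smooth_on S f \<Longrightarrow> smooth_on S (\<lambda>x. frechet_derivative f (at x) v)"
  unfolding smooth_on_def using ck_on.simps(2) by blast

text \<open>Cramer's rule writes a component of \<open>A\<inverse> v\<close> as a rational expression in the entries of
  \<open>A\<close>, so inverting a matrix whose entries are of class \<open>C\<^sup>k\<close> stays in the class \<open>C\<^sup>k\<close>.\<close>

lemma cramer_inverse_component:
  fixes A :: "real ^ 'n::finite ^ 'n"
  assumes "A *v x = v" "det A \<noteq> 0"
  shows "x $ k = det (\<chi> i j. if j = k then v $ i else A $ i $ j) * inverse (det A)"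
proof -
  have "det (\<chi> i j. if j = k then v $ i else A $ i $ j) = x $ k * det A"
    using cramer_lemma[of k A x] unfolding assms(1) .
  then show ?thesis using assms(2) by (simp add: field_simps)
qed

text \<open>The inverse function theorem gives a differentiable local inverse \<open>g\<close> whose derivative at
  \<open>y\<close> is the inverse of the derivative of \<open>f\<close> at \<open>g y\<close>.  Regularity is bootstrapped from this
  identity: if \<open>g\<close> is of class \<open>C\<^sup>k\<close>, then so is the matrix of the derivative of \<open>f\<close> at \<open>g y\<close>,
  hence by Cramer's rule also its inverse, and therefore \<open>g\<close> is of class \<open>C\<^sup>k\<^sup>+\<^sup>1\<close>.\<close>

theorem smooth_inverse_function:
  fixes f :: "real ^ 'n::finite \<Rightarrow> real ^ 'n"
  assumes "open S" "smooth_on S f" "x0 \<in> S"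
    and inj: "\<And>v. frechet_derivative f (at x0) v = 0 \<Longrightarrow> v = 0"
  obtains W g where "open W" "W \<subseteq> S" "x0 \<in> W" "open (f ` W)" "smooth_on (f ` W) g"
    "\<And>x. x \<in> W \<Longrightarrow> g (f x) = x"
proof -
  let ?D = "\<lambda>x. frechet_derivative f (at x)"
  have der: "(f has_derivative ?D x) (at x)" if "x \<in> S" for x
    using smooth_on_derivative assms(2) that by blast
  have bl: "bounded_linear (?D x)" if "x \<in> S" for x
    using der[OF that] has_derivative_bounded_linear by blast
  define f' where "f' x = Blinfun (?D x)" for x
  have f': "blinfun_apply (f' x) = ?D x" if "x \<in> S" for x
    unfolding f'_def using bl[OF that] by (simp add: bounded_linear_Blinfun_apply)
  have "continuous_on S (\<lambda>x. ?D x v)" for v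
    using smooth_on_continuous[OF smooth_on_frechet_derivative[OF assms(2)]] .
  then have "continuous_on S (\<lambda>x. blinfun_apply (f' x) v)" for v
    using continuous_on_cong[of S S "\<lambda>x. blinfun_apply (f' x) v" "\<lambda>x. ?D x v"] f' by simp
  then have cont: "continuous_on S f'"
    using continuous_blinfun_componentwiseI1 by (intro continuous_on_blinfun_componentwise) auto
  have "linear (?D x0)" using bl[OF assms(3)] by (simp add: bounded_linear.linear)
  then have "inj (?D x0)" using inj linear_injective_0 by blast
  then obtain h where h: "linear h" "h \<circ> ?D x0 = id"
    using linear_injective_left_inverse \<open>linear (?D x0)\<close> by blast
  have inv: "Blinfun h o\<^sub>L f' x0 = id_blinfun"
  proof (rule blinfun_eqI)
    fix v
    have "blinfun_apply (Blinfun h) w = h w" for w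
      using h(1) by (simp add: bounded_linear_Blinfun_apply linear_conv_bounded_linear)
    then show "blinfun_apply (Blinfun h o\<^sub>L f' x0) v = blinfun_apply id_blinfun v"
      using h(2) f'[OF assms(3)] by (simp add: fun_eq_iff)
  qed
  have der': "(f has_derivative blinfun_apply (f' x)) (at x)" if "x \<in> S" for x
    using der f' that by simp
  have "\<exists>W V g g'. open W \<and> W \<subseteq> S \<and> x0 \<in> W \<and> open V \<and> homeomorphism W V f g \<and>
      (\<forall>y\<in>V. (g has_derivative (g' y)) (at y) \<and> g' y = inv (blinfun_apply (f' (g y))) \<and>
        bij (blinfun_apply (f' (g y))))"
  proof (rule inverse_function_theorem[OF assms(1) der' cont assms(3) inv])
    fix W V g g'
    assume "open W" "W \<subseteq> S" "x0 \<in> W" "open V" "homeomorphism W V f g"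
      "\<And>y. y \<in> V \<Longrightarrow> (g has_derivative (g' y)) (at y)"
      "\<And>y. y \<in> V \<Longrightarrow> g' y = inv (blinfun_apply (f' (g y)))"
      "\<And>y. y \<in> V \<Longrightarrow> bij (blinfun_apply (f' (g y)))"
    then show ?thesis
      by (intro exI[of _ W] exI[of _ V] exI[of _ g] exI[of _ g'] conjI ballI)
  qed
  then obtain W V g g' where W: "open W" "W \<subseteq> S" "x0 \<in> W" "open V" "homeomorphism W V f g"
    and g': "\<And>y. y \<in> V \<Longrightarrow> (g has_derivative (g' y)) (at y)"
      "\<And>y. y \<in> V \<Longrightarrow> g' y = inv (blinfun_apply (f' (g y)))"
      "\<And>y. y \<in> V \<Longrightarrow> bij (blinfun_apply (f' (g y)))"
    by blast
  have V: "V = f ` W" and gW: "g ` V = W" and gf: "\<And>x. x \<in> W \<Longrightarrow> g (f x) = x"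
    using W(5) by (auto simp: homeomorphism_def)
  define A where "A x = matrix (?D x)" for x
  have A: "A x *v v = ?D x v" if "x \<in> S" for x v
    unfolding A_def using bl[OF that] by (simp add: matrix_works bounded_linear.linear)
  have Aij: "A x $ i $ j = ?D x (axis j 1) $ i" for x i j
    by (simp add: A_def matrix_def)
  have detA: "det (A (g y)) \<noteq> 0" if "y \<in> V" for y
  proof -
    have "g y \<in> S" using gW W(2) that by auto
    then have "linear (?D (g y))" "inj (?D (g y))"
      using bl g'(3)[OF that] f' by (auto simp: bounded_linear.linear bij_is_inj)
    then show ?thesis
      unfolding A_def by (simp add: det_nz_iff_inj)
  qed
  have "ck_on k V g" for k
  proof (induction k)
    case 0
    then show ?case using W(5) by (simp add: homeomorphism_def)
  next
    case (Suc k)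
    have D: "ck_on k V (\<lambda>y. A (g y) $ i $ j)" for i j
      unfolding Aij
    proof (rule ck_on_compose[OF W(4) assms(1) Suc])
      have "smooth_on S (\<lambda>x. ?D x (axis j 1))" by (rule smooth_on_frechet_derivative[OF assms(2)])
      then show "ck_on k S (\<lambda>x. ?D x (axis j 1) $ i)"
        using ck_on_vec_iff[OF assms(1), of k "\<lambda>x. ?D x (axis j 1)"] by (auto simp: smooth_on_def)
    qed (use gW W(2) in auto)
    show ?case
    proof (rule ck_on_Suc_derivI[OF W(4) g'(1)])
      fix v
      have 1: "ck_on k V (\<lambda>y. det (\<chi> i j. if j = m then v $ i else A (g y) $ i $ j)
          * inverse (det (A (g y))))" for m
      proof (intro ck_on_mult ck_on_inverse ck_on_det W(4) D detA)
        show "ck_on k V (\<lambda>y. (\<chi> i j. if j = m then v $ i else A (g y) $ i $ j) $ i $ j)" for i j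
          by (cases "j = m") (simp_all add: D ck_on_const)
      qed
      have 2: "det (\<chi> i j. if j = m then v $ i else A (g y) $ i $ j) * inverse (det (A (g y)))
          = g' y v $ m" if "y \<in> V" for y m
      proof (rule cramer_inverse_component[symmetric])
        have "g y \<in> S" using gW W(2) that by auto
        then show "A (g y) *v g' y v = v"
          using g'(3)[OF that] by (simp add: A g'(2)[OF that] f' bij_is_surj surj_f_inv_f)
      qed (use detA that in auto)
      have "ck_on k V (\<lambda>y. g' y v $ m)" for m
        by (rule ck_on_cong[OF W(4) 2 1])
      then show "ck_on k V (\<lambda>y. g' y v)"
        using ck_on_vec_iff[OF W(4), of k "\<lambda>y. g' y v"] by simp
    qed
  qed
  then have "smooth_on V g" by (simp add: smooth_on_def)
  then show ?thesis using that W V gf by blast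
qed

section \<open>Primitives in one coordinate\<close>

definition scale_coord :: "'n::finite \<Rightarrow> real \<Rightarrow> real ^ 'n \<Rightarrow> real ^ 'n" where
  "scale_coord k t x = x + ((t - 1) * x $ k) *\<^sub>R axis k 1"

lemma scale_coord_component: "scale_coord k t x $ i = (if i = k then t * x $ i else x $ i)"
  by (auto simp: scale_coord_def axis_def algebra_simps)

lemma bounded_linear_scale_coord: "bounded_linear (scale_coord k t)"
  by (rule linear_conv_bounded_linear[THEN iffD1], rule linearI)
     (auto simp: vec_eq_iff scale_coord_component algebra_simps)

lemma norm_scale_coord_le:
  assumes "t \<in> {0..1}"
  shows "norm (scale_coord k t x) \<le> norm x"
proof (rule norm_le_componentwise_cart)
  show "norm (scale_coord k t x $ i) \<le> norm (x $ i)" for i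
    using assms by (auto simp: scale_coord_component abs_mult mult_left_le_one_le)
qed

lemma scale_coord_ball:
  "x \<in> ball 0 r \<Longrightarrow> t \<in> {0..1} \<Longrightarrow> scale_coord k t x \<in> ball 0 r"
  using norm_scale_coord_le[of t k x] by (auto simp: dist_norm)

lemma continuous_on_scale_coord:
  assumes "continuous_on (ball 0 r) f"
  shows "continuous_on (ball 0 r \<times> {0..1}) (\<lambda>(x, t). f (scale_coord k t x))"
  unfolding case_prod_beta
proof (rule continuous_on_compose2[OF assms])
  show "continuous_on (ball 0 r \<times> {0..1}) (\<lambda>p. scale_coord k (snd p) (fst p))"
    unfolding scale_coord_def by (intro continuous_intros)
  show "(\<lambda>p. scale_coord k (snd p) (fst p)) ` (ball 0 r \<times> {0..1}) \<subseteq> ball 0 r"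
    using scale_coord_ball by fastforce
qed

text \<open>Differentiation under the integral sign.  The weight \<open>w\<close> is there because differentiating
  produces factors \<open>t - 1\<close> from the derivative of \<open>scale_coord k t\<close>; with an arbitrary weight
  the class of integrals is closed under differentiation.\<close>

lemma scaled_integral_has_derivative:
  fixes f :: "real ^ 'n::finite \<Rightarrow> real"
  assumes f: "ck_on (Suc 0) (ball 0 r) f" and w: "continuous_on {0..1} w" and x: "x \<in> ball 0 r"
  shows "((\<lambda>x. integral {0..1} (\<lambda>t. w t * f (scale_coord k t x))) has_derivative
    (\<lambda>v. integral {0..1} (\<lambda>t. w t *
      frechet_derivative f (at (scale_coord k t x)) (scale_coord k t v)))) (at x)"
proof -
  let ?B = "ball 0 r :: (real ^ 'n) set" and ?D = "\<lambda>x. frechet_derivative f (at x)"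
  define F where "F x t = Blinfun (\<lambda>v. w t * ?D (scale_coord k t x) (scale_coord k t v))" for x t
  have der: "(f has_derivative ?D y) (at y)" if "y \<in> ?B" for y
    using f that by (simp add: frechet_derivative_works[symmetric])
  have bl: "bounded_linear (\<lambda>v. w t * ?D (scale_coord k t y) (scale_coord k t v))"
    if "y \<in> ?B" "t \<in> {0..1}" for y t
    using bounded_linear_compose[OF has_derivative_bounded_linear[OF der[OF scale_coord_ball[OF that]]]
        bounded_linear_scale_coord]
    by (rule bounded_linear_const_mult)
  have F: "blinfun_apply (F y t) = (\<lambda>v. w t * ?D (scale_coord k t y) (scale_coord k t v))"
    if "y \<in> ?B" "t \<in> {0..1}" for y t
    unfolding F_def using bl[OF that] by (simp add: bounded_linear_Blinfun_apply)
  \<comment> \<open>Splitting the direction shows joint continuity in \<open>(y, t)\<close>: the derivative is evaluated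
      at vectors that do not depend on \<open>t\<close>.\<close>
  have lin: "?D y (scale_coord k t v) = ?D y v + ((t - 1) * v $ k) * ?D y (axis k 1)"
    if "y \<in> ?B" for y t v
    using bounded_linear.linear[OF has_derivative_bounded_linear[OF der[OF that]]]
    by (simp add: scale_coord_def linear_add linear_cmul)
  have contw: "continuous_on (?B \<times> {0..1}) (\<lambda>p. w (snd p))"
    by (rule continuous_on_compose2[OF w continuous_on_snd[OF continuous_on_id]]) auto
  have contD: "continuous_on (?B \<times> {0..1}) (\<lambda>p. ?D (scale_coord k (snd p) (fst p)) v)" for v
    using continuous_on_scale_coord[of r "\<lambda>x. ?D x v" k] f by (simp add: case_prod_beta)
  have contF: "continuous_on (?B \<times> {0..1}) (\<lambda>(y, t). F y t)"
    unfolding case_prod_beta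
  proof (rule continuous_on_blinfun_componentwise)
    fix v :: "real ^ 'n"
    have "continuous_on (?B \<times> {0..1}) (\<lambda>p. w (snd p) * (?D (scale_coord k (snd p) (fst p)) v +
        ((snd p - 1) * v $ k) * ?D (scale_coord k (snd p) (fst p)) (axis k 1)))"
      by (intro continuous_intros contw contD)
    then show "continuous_on (?B \<times> {0..1}) (\<lambda>p. blinfun_apply (F (fst p) (snd p)) v)"
    proof (rule continuous_on_eq)
      fix p assume "p \<in> ?B \<times> {0..1::real}"
      then have p: "fst p \<in> ?B" "snd p \<in> {0..1}" by auto
      show "w (snd p) * (?D (scale_coord k (snd p) (fst p)) v +
          ((snd p - 1) * v $ k) * ?D (scale_coord k (snd p) (fst p)) (axis k 1)) =
          blinfun_apply (F (fst p) (snd p)) v"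
        unfolding F[OF p] lin[OF scale_coord_ball[OF p]] ..
    qed
  qed
  have cont1: "continuous_on {0..1} (\<lambda>t. w t * f (scale_coord k t y))" if "y \<in> ?B" for y
  proof (intro continuous_intros w)
    have "continuous_on {0..1} ((\<lambda>(x, t). f (scale_coord k t x)) \<circ> (\<lambda>t. (y, t)))"
      using that
      by (intro continuous_on_compose continuous_intros
          continuous_on_subset[OF continuous_on_scale_coord[OF ck_on_continuous[OF f]]]) auto
    then show "continuous_on {0..1} (\<lambda>t. f (scale_coord k t y))" by (simp add: o_def)
  qed
  have "((\<lambda>x. integral (cbox 0 1) (\<lambda>t. w t * f (scale_coord k t x))) has_derivative
      blinfun_apply (integral (cbox 0 1) (F x))) (at x within ?B)"
  proof (rule leibniz_rule[where fx = F])
    show "((\<lambda>x. w t * f (scale_coord k t x)) has_derivative blinfun_apply (F y t)) (at y within ?B)"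
      if "y \<in> ?B" "t \<in> cbox 0 1" for y t
    proof -
      have t: "t \<in> {0..1}" using that by simp
      have "((\<lambda>x. f (scale_coord k t x)) has_derivative (\<lambda>v. ?D (scale_coord k t y) (scale_coord k t v)))
          (at y within ?B)"
        by (rule has_derivative_compose[OF bounded_linear_imp_has_derivative[OF bounded_linear_scale_coord]
              der[OF scale_coord_ball[OF that(1) t]]])
      then show ?thesis
        unfolding F[OF that(1) t] by (rule has_derivative_mult_right)
    qed
  qed (use x contF cont1 in \<open>auto intro!: integrable_continuous_interval\<close>)
  moreover have "blinfun_apply (integral (cbox 0 1) (F x)) v =
      integral {0..1} (\<lambda>t. w t * ?D (scale_coord k t x) (scale_coord k t v))" for v
  proof -
    have "continuous_on {0..1} ((\<lambda>(y, t). F y t) \<circ> (\<lambda>t. (x, t)))"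
      using x by (intro continuous_on_compose continuous_intros continuous_on_subset[OF contF]) auto
    then have "F x integrable_on {0..1}"
      by (intro integrable_continuous_interval) (simp add: o_def)
    then have "blinfun_apply (integral {0..1} (F x)) v = integral {0..1} (\<lambda>t. blinfun_apply (F x t) v)"
      by (rule blinfun_apply_integral)
    also have "\<dots> = integral {0..1} (\<lambda>t. w t * ?D (scale_coord k t x) (scale_coord k t v))"
      by (rule integral_cong) (simp only: F[OF x])
    finally show ?thesis by simp
  qed
  then have "blinfun_apply (integral (cbox 0 1) (F x)) =
      (\<lambda>v. integral {0..1} (\<lambda>t. w t * ?D (scale_coord k t x) (scale_coord k t v)))" by (rule ext)
  ultimately show ?thesis
    using x by (simp add: at_within_open[of x ?B])
qed

lemma ck_on_scaled_integral:
  fixes f :: "real ^ 'n::finite \<Rightarrow> real"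
  assumes "\<And>m. ck_on m (ball 0 r) f" "continuous_on {0..1} w"
  shows "ck_on m (ball 0 r) (\<lambda>x. integral {0..1} (\<lambda>t. w t * f (scale_coord k t x)))"
  using assms
proof (induction m arbitrary: f w)
  case 0
  have "(\<lambda>x. integral {0..1} (\<lambda>t. w t * f (scale_coord k t x))) differentiable at x"
    if "x \<in> ball 0 r" for x
    using scaled_integral_has_derivative[OF 0 that] by (auto simp: differentiable_def)
  then show ?case
    by (auto intro!: continuous_at_imp_continuous_on differentiable_imp_continuous_within)
next
  case (Suc m)
  let ?D = "\<lambda>x. frechet_derivative f (at x)"
  show ?case
  proof (rule ck_on_Suc_derivI[OF open_ball scaled_integral_has_derivative[OF Suc.prems]])
    fix v :: "real ^ 'n"
    have D: "ck_on m (ball 0 r) (\<lambda>x. ?D x u)" for m u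
      using Suc.prems(1)[of "Suc m"] by simp
    define I where "I w u x = integral {0..1} (\<lambda>t. w t * ?D (scale_coord k t x) u)" for w u x
    have ck: "ck_on m (ball 0 r) (\<lambda>x. I w v x + v $ k * I (\<lambda>t. w t * (t - 1)) (axis k 1) x)"
      unfolding I_def
      by (intro ck_on_add ck_on_mult ck_on_const open_ball Suc.IH D continuous_intros Suc.prems(2))
    have eq: "I w v x + v $ k * I (\<lambda>t. w t * (t - 1)) (axis k 1) x =
        integral {0..1} (\<lambda>t. w t * ?D (scale_coord k t x) (scale_coord k t v))"
      if x: "x \<in> ball 0 r" for x
    proof -
      have cont: "continuous_on {0..1} (\<lambda>t. ?D (scale_coord k t x) u)" for u
      proof -
        have "continuous_on {0..1} ((\<lambda>(x, t). ?D (scale_coord k t x) u) \<circ> (\<lambda>t. (x, t)))"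
          using x
          by (intro continuous_on_compose continuous_intros
              continuous_on_subset[OF continuous_on_scale_coord[OF ck_on_continuous[OF D]]]) auto
        then show ?thesis by (simp add: o_def)
      qed
      have lin: "linear (?D (scale_coord k t x))" if "t \<in> {0..1}" for t
        using Suc.prems(1)[of "Suc 0"] scale_coord_ball[OF x that] linear_frechet_derivative
        by (metis ck_on.simps(2))
      have split: "?D (scale_coord k t x) (scale_coord k t v) =
          ?D (scale_coord k t x) v + v $ k * ((t - 1) * ?D (scale_coord k t x) (axis k 1))"
        if "t \<in> {0..1}" for t
        unfolding scale_coord_def[of k t v] using lin[OF that] by (simp add: linear_add linear_cmul)
      have "integral {0..1} (\<lambda>t. w t * ?D (scale_coord k t x) (scale_coord k t v)) =
          integral {0..1} (\<lambda>t. w t * ?D (scale_coord k t x) v +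
            v $ k * (w t * (t - 1) * ?D (scale_coord k t x) (axis k 1)))"
        by (rule integral_cong) (simp add: split algebra_simps)
      also have "\<dots> = I w v x + v $ k * I (\<lambda>t. w t * (t - 1)) (axis k 1) x"
        unfolding I_def integral_mult_right[symmetric]
        by (intro integral_add integrable_continuous_interval continuous_intros cont Suc.prems(2))
      finally show ?thesis by simp
    qed
    show "ck_on m (ball 0 r)
        (\<lambda>x. integral {0..1} (\<lambda>t. w t * ?D (scale_coord k t x) (scale_coord k t v)))"
      by (rule ck_on_cong[OF open_ball eq ck])
  qed auto
qed

text \<open>This is the primitive of \<open>f\<close> in the \<open>k\<close>-th coordinate, the integral of \<open>f\<close> along the
  segment from the point with \<open>x\<^sub>k\<close> replaced by \<open>0\<close> to \<open>x\<close>.  The substitution to the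
  fixed interval \<open>{0..1}\<close> leaves no parameter in the bounds and no distinction of the sign
  of \<open>x\<^sub>k\<close>.\<close>

definition coord_primitive :: "'n::finite \<Rightarrow> (real ^ 'n \<Rightarrow> real) \<Rightarrow> real ^ 'n \<Rightarrow> real" where
  "coord_primitive k f x = x $ k * integral {0..1} (\<lambda>t. f (scale_coord k t x))"

lemma smooth_coord_primitive:
  assumes "smooth_on (ball 0 r) f"
  shows "smooth_on (ball 0 r) (coord_primitive k f)"
proof -
  have "ck_on m (ball 0 r) (coord_primitive k f)" for m
    using ck_on_scaled_integral[of r f "\<lambda>_. 1" m k] assms
      ck_on_bounded_linear[OF bounded_linear_vec_nth, of m "ball 0 r" k]
    unfolding coord_primitive_def by (intro ck_on_mult) (auto simp: smooth_on_def)
  then show ?thesis by (simp add: smooth_on_def)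
qed

text \<open>Differentiating under the integral sign turns the integrand into the \<open>t\<close>-derivative of
  \<open>t * f (scale_coord k t x)\<close>, whose values at \<open>0\<close> and \<open>1\<close> are \<open>0\<close> and \<open>f x\<close>.\<close>

lemma coord_primitive_derivative:
  assumes f: "smooth_on (ball 0 r) f" and x: "x \<in> ball 0 r"
  shows "frechet_derivative (coord_primitive k f) (at x) (axis k 1) = f x"
proof -
  let ?D = "\<lambda>x. frechet_derivative f (at x)" and ?s = "\<lambda>t. scale_coord k t x"
  have fc: "ck_on m (ball 0 r) f" for m using f by (simp add: smooth_on_def)
  have der: "(f has_derivative ?D y) (at y)" if "y \<in> ball 0 r" for y
    using smooth_on_derivative[OF f that] .
  have I: "((\<lambda>x. integral {0..1} (\<lambda>t. f (scale_coord k t x))) has_derivative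
      (\<lambda>v. integral {0..1} (\<lambda>t. ?D (?s t) (scale_coord k t v)))) (at x)"
    using scaled_integral_has_derivative[OF fc continuous_on_const[where c=1] x] by simp
  have "(coord_primitive k f has_derivative (\<lambda>v. x $ k * integral {0..1} (\<lambda>t. ?D (?s t) (scale_coord k t v))
      + v $ k * integral {0..1} (\<lambda>t. f (?s t)))) (at x)"
    unfolding coord_primitive_def
    by (intro has_derivative_mult I bounded_linear_imp_has_derivative bounded_linear_vec_nth)
  then have "frechet_derivative (coord_primitive k f) (at x) (axis k 1) =
      x $ k * integral {0..1} (\<lambda>t. ?D (?s t) (scale_coord k t (axis k 1)))
      + integral {0..1} (\<lambda>t. f (?s t))"
    by (simp add: frechet_derivative_at[symmetric])
  also have "\<dots> = integral {0..1} (\<lambda>t. x $ k * ?D (?s t) (scale_coord k t (axis k 1)) + f (?s t))"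
  proof -
    have c: "continuous_on {0..1} (\<lambda>t. g (?s t))" if "continuous_on (ball 0 r) g" for g :: "real ^ 'a \<Rightarrow> real"
    proof -
      have "continuous_on {0..1} ((\<lambda>(x, t). g (scale_coord k t x)) \<circ> (\<lambda>t. (x, t)))"
        using x
        by (intro continuous_on_compose continuous_intros
            continuous_on_subset[OF continuous_on_scale_coord[OF that]]) auto
      then show ?thesis by (simp add: o_def)
    qed
    have "continuous_on {0..1} (\<lambda>t. t * ?D (?s t) (axis k 1))"
      by (intro continuous_intros c smooth_on_continuous smooth_on_frechet_derivative f)
    then have "continuous_on {0..1} (\<lambda>t. ?D (?s t) (scale_coord k t (axis k 1)))"
    proof (rule continuous_on_eq)
      fix t :: real assume "t \<in> {0..1}"
      then have "linear (?D (?s t))"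
        using der[OF scale_coord_ball[OF x]] has_derivative_linear by blast
      moreover have "scale_coord k t (axis k 1) = t *\<^sub>R axis k 1"
        by (simp add: vec_eq_iff scale_coord_component axis_def)
      ultimately show "t * ?D (?s t) (axis k 1) = ?D (?s t) (scale_coord k t (axis k 1))"
        by (simp add: linear_cmul)
    qed
    then show ?thesis
      unfolding integral_mult_right[symmetric]
      by (intro integral_add[symmetric] integrable_continuous_interval continuous_intros c
          smooth_on_continuous[OF f])
  qed
  also have "\<dots> = 1 * f (?s 1) - 0 * f (?s 0)"
  proof (rule integral_unique, rule fundamental_theorem_of_calculus)
    fix t :: real assume t: "t \<in> {0..1}"
    have s: "(?s has_derivative (\<lambda>h. h *\<^sub>R (x $ k *\<^sub>R axis k 1))) (at t within {0..1})"
      unfolding scale_coord_def by (auto intro!: derivative_eq_intros simp: algebra_simps)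
    have lin: "linear (?D (?s t))"
      using der[OF scale_coord_ball[OF x t]] has_derivative_linear by blast
    have "((\<lambda>t. f (?s t)) has_derivative (\<lambda>h. ?D (?s t) (h *\<^sub>R (x $ k *\<^sub>R axis k 1)))) (at t within {0..1})"
      by (rule has_derivative_compose[OF s der[OF scale_coord_ball[OF x t]]])
    then have "((\<lambda>t. f (?s t)) has_derivative (\<lambda>h. h * (x $ k * ?D (?s t) (axis k 1)))) (at t within {0..1})"
      using lin by (simp add: linear_cmul mult.assoc)
    then have "((\<lambda>t. t * f (?s t)) has_derivative
        (\<lambda>h. t * (h * (x $ k * ?D (?s t) (axis k 1))) + h * f (?s t))) (at t within {0..1})"
      by (rule has_derivative_mult[OF has_derivative_ident])
    moreover have "scale_coord k t (axis k 1) = t *\<^sub>R axis k 1"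
      by (simp add: vec_eq_iff scale_coord_component axis_def)
    ultimately show "((\<lambda>t. t * f (?s t)) has_vector_derivative
        x $ k * ?D (?s t) (scale_coord k t (axis k 1)) + f (?s t)) (at t within {0..1})"
      unfolding has_vector_derivative_def using lin by (simp add: linear_cmul algebra_simps)
  qed simp
  finally show ?thesis by (simp add: scale_coord_def)
qed

section \<open>Alternating forms of top degree\<close>

text \<open>Polarisation of the vanishing on equal arguments.\<close>

lemma alternating_form_swap:
  fixes f :: "('n::finite \<Rightarrow> 'v::real_vector) \<Rightarrow> real"
  assumes lin: "\<And>u i x y r s. f (u(i := r *\<^sub>R x + s *\<^sub>R y)) = r * f (u(i := x)) + s * f (u(i := y))"
    and alt: "\<And>u i j. i \<noteq> j \<Longrightarrow> u i = u j \<Longrightarrow> f u = 0"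
    and "i \<noteq> j"
  shows "f (u(i := u j, j := u i)) = - f u"
proof -
  have add: "f (u(i := x + y)) = f (u(i := x)) + f (u(i := y))" for u i x y
    using lin[of u i 1 x 1 y] by simp
  let ?g = "\<lambda>x y. f (u(i := x, j := y))"
  have "?g (u i + u j) (u i + u j) = 0" "?g (u i) (u i) = 0" "?g (u j) (u j) = 0"
    using assms(3) by (auto intro!: alt[of i j])
  moreover have "?g (x + y) z = ?g x z + ?g y z" for x y z
    using add[of "u(j := z)" i x y] assms(3) by (simp add: fun_upd_twist)
  moreover have "?g z (x + y) = ?g z x + ?g z y" for x y z
    using add[of "u(i := z)" j x y] by simp
  ultimately show ?thesis by simp
qed

text \<open>Row reduction: both sides react in the same way to the elementary operations.  A column
  operation on \<open>A\<close> acts inside each argument of \<open>f\<close> rather than between the arguments, so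
  that step applies the induction hypothesis to \<open>f\<close> composed with the coordinate swap; hence
  the induction is over all \<open>f\<close> at once.\<close>

lemma alternating_form_eq_det_rows:
  fixes f :: "('n::finite \<Rightarrow> real ^ 'n) \<Rightarrow> real"
  assumes "\<And>u i x y r s. f (u(i := r *\<^sub>R x + s *\<^sub>R y)) = r * f (u(i := x)) + s * f (u(i := y))"
    and "\<And>u i j. i \<noteq> j \<Longrightarrow> u i = u j \<Longrightarrow> f u = 0"
  shows "f (\<lambda>i. A $ i) = det A * f (\<lambda>i. axis i 1)"
  using assms
proof (induction A arbitrary: f 
    rule: induct_matrix_row_operations[case_names zero_row diagonal swap_cols row_op])
  case (zero_row A i)
  have "A $ i = 0" using zero_row(1) by (simp add: row_def vec_lambda_eta)
  then have "(\<lambda>i. A $ i)(i := 0) = (\<lambda>i. A $ i)" by auto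
  then have "f (\<lambda>i. A $ i) = 0"
    using zero_row(2)[of "\<lambda>i. A $ i" i 0 0 0 0] by simp
  moreover have "det A = 0" using zero_row(1) by (rule det_zero_row(2))
  ultimately show ?case by simp
next
  case (diagonal A)
  have scale: "f (u(i := r *\<^sub>R x)) = r * f (u(i := x))" for u i r x
    using diagonal(2)[of u i r x 0 0] by (simp add: fun_upd_def)
  have *: "f (\<lambda>i. if i \<in> S then d i *\<^sub>R v i else v i) = (\<Prod>i\<in>S. d i) * f v" for S d v
  proof (induction S rule: infinite_finite_induct)
    case (insert k S)
    let ?u = "\<lambda>i. if i \<in> S then d i *\<^sub>R v i else v i"
    have "(\<lambda>i. if i \<in> insert k S then d i *\<^sub>R v i else v i) = ?u(k := d k *\<^sub>R v k)"
      by auto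
    moreover have "?u(k := v k) = ?u" using insert by auto
    ultimately show ?case using insert scale[of ?u k "d k" "v k"] by simp
  qed auto
  have rows: "(\<lambda>i. A $ i) = (\<lambda>i. A $ i $ i *\<^sub>R axis i 1)"
    using diagonal(1) by (auto simp: fun_eq_iff vec_eq_iff axis_def)
  have "f (\<lambda>i. A $ i $ i *\<^sub>R axis i 1) = (\<Prod>i\<in>UNIV. A $ i $ i) * f (\<lambda>i. axis i 1)"
    using *[of UNIV "\<lambda>i. A $ i $ i" "\<lambda>i. axis i 1"] by simp
  then show ?case
    unfolding rows[symmetric] by (simp add: det_diagonal diagonal(1))
next
  case (swap_cols A m n)
  let ?t = "Transposition.transpose m n"
  define p :: "real ^ 'n \<Rightarrow> real ^ 'n" where "p x = (\<chi> j. x $ ?t j)" for x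
  have p_lin: "p (r *\<^sub>R x + s *\<^sub>R y) = r *\<^sub>R p x + s *\<^sub>R p y" for r s x y
    by (simp add: p_def vec_eq_iff)
  have p_axis: "p (axis i 1) = axis (?t i) 1" for i
    by (auto simp: p_def vec_eq_iff axis_def)
  have p_upd: "(\<lambda>k. p ((u(i := x)) k)) = (\<lambda>k. p (u k))(i := p x)" for u :: "'n \<Rightarrow> real ^ 'n" and i x
    by auto
  have "f (\<lambda>i. p (A $ i)) = det A * f (\<lambda>i. p (axis i 1))"
  proof (rule swap_cols.IH[of "\<lambda>u. f (\<lambda>i. p (u i))"])
    show "f (\<lambda>k. p ((u(i := r *\<^sub>R x + s *\<^sub>R y)) k)) =
        r * f (\<lambda>k. p ((u(i := x)) k)) + s * f (\<lambda>k. p ((u(i := y)) k))" for u i x y r s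
      unfolding p_upd p_lin by (rule swap_cols.prems(1))
    show "f (\<lambda>i. p (u i)) = 0" if "i \<noteq> j" "u i = u j" for u i j
      using that by (intro swap_cols.prems(2)[of i j]) auto
  qed
  also have "(\<lambda>i. p (axis i 1)) = (\<lambda>i. axis i 1)(m := axis n 1, n := axis m 1)"
    by (auto simp: p_axis Transposition.transpose_def)
  also have "f \<dots> = - f (\<lambda>i. axis i 1)"
    by (rule alternating_form_swap[of f m n "\<lambda>i. axis i 1", OF swap_cols.prems swap_cols(2)])
  finally show ?case
    using det_permute_columns[of ?t A] swap_cols(2) by (simp add: p_def permutes_swap_id sign_swap_id)
next
  case (row_op A m n c)
  let ?B = "\<chi> i. if i = m then row m A + c *\<^sub>R row n A else row i A"
  have "f ((\<lambda>i. A $ i)(m := A $ n)) = 0"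
    using row_op(2) by (intro row_op.prems(2)[of m n]) auto
  then have e1: "f ((\<lambda>i. A $ i)(m := A $ m + c *\<^sub>R A $ n)) = f (\<lambda>i. A $ i)"
    using row_op.prems(1)[of "\<lambda>i. A $ i" m 1 "A $ m" c "A $ n"] by (simp add: fun_upd_def)
  have e2: "(\<lambda>i. ?B $ i) = (\<lambda>i. A $ i)(m := A $ m + c *\<^sub>R A $ n)"
    by (auto simp: row_def vec_lambda_eta fun_eq_iff)
  have e3: "det ?B = det A"
    using det_row_operation[OF row_op(2), of A c] unfolding scalar_mult_eq_scaleR .
  show ?case unfolding e1 e2 e3 by (rule row_op.IH[OF row_op.prems])
qed

lemma alternating_form_eq_std_volume:
  fixes f :: "('n::finite \<Rightarrow> real ^ 'n) \<Rightarrow> real"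
  assumes "\<And>u i x y r s. f (u(i := r *\<^sub>R x + s *\<^sub>R y)) = r * f (u(i := x)) + s * f (u(i := y))"
    and "\<And>u i j. i \<noteq> j \<Longrightarrow> u i = u j \<Longrightarrow> f u = 0"
  shows "f u = std_volume u * f (\<lambda>i. axis i 1)"
proof -
  have "std_volume u = det (\<chi> i. u i)"
    unfolding std_volume_def by (subst det_transpose[symmetric]) (simp add: transpose_def vec_lambda_eta)
  then show ?thesis
    using alternating_form_eq_det_rows[of f "\<chi> i. u i"] assms by simp
qed

text \<open>Cramer's rule for the identity matrix.  Such matrices are the Jacobians of maps that change
  one coordinate only.\<close>

lemma det_replace_row_of_identity:
  fixes d :: "real ^ 'n::finite"
  shows "det (\<chi> i j. if i = k then d $ j else (mat 1 :: real ^ 'n ^ 'n) $ i $ j) = d $ k"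
proof -
  have "(\<chi> i. if i = k then \<Sum>i\<in>UNIV. d $ i *s row i (mat 1) else row i (mat 1)) =
      (\<chi> i j. if i = k then d $ j else (mat 1 :: real ^ 'n ^ 'n) $ i $ j)"
    by (simp add: vec_eq_iff row_def mat_def if_distrib[of "\<lambda>x. _ * x"] cong: if_cong)
  then show ?thesis
    using cramer_lemma_transpose[of k d "mat 1"] by simp
qed

section \<open>Charts and their transition maps\<close>

lemma smooth_chart_is_chart: "c \<in> smooth_charts M \<Longrightarrow> is_chart M c"
  by (simp add: smooth_charts_def)

lemma charts_atD: "c \<in> charts_at M p \<Longrightarrow> c \<in> smooth_charts M" "c \<in> charts_at M p \<Longrightarrow> p \<in> fst c"
  by (auto simp: charts_at_def)

lemma chart_inv_left:
  assumes "is_chart M c" "p \<in> fst c"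
  shows "chart_inv c (snd c p) = p"
proof -
  have "inj_on (snd c) (topspace (subtopology (Top M) (fst c)))"
    using assms(1) homeomorphic_imp_injective_map unfolding is_chart_def by blast
  then have "inj_on (snd c) (fst c)"
    using assms(1) openin_subset unfolding is_chart_def by (metis topspace_subtopology_subset)
  then show ?thesis using assms(2) by (simp add: chart_inv_def)
qed

lemma chart_inv_right: "y \<in> snd c ` fst c \<Longrightarrow> snd c (chart_inv c y) = y"
  by (simp add: chart_inv_def f_inv_into_f)

lemma chart_inv_in: "y \<in> snd c ` fst c \<Longrightarrow> chart_inv c y \<in> fst c"
  by (simp add: chart_inv_def inv_into_into)

lemma chart_domain_subset: "is_chart M c \<Longrightarrow> fst c \<subseteq> topspace (Top M)"
  by (simp add: is_chart_def openin_subset)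

lemma continuous_map_chart:
  assumes "is_chart M c"
  shows "continuous_map (subtopology (Top M) (fst c)) euclidean (snd c)"
  using assms homeomorphic_imp_continuous_map continuous_map_in_subtopology
  unfolding is_chart_def by blast

lemma continuous_map_chart_inv:
  assumes "is_chart M c"
  shows "continuous_map (top_of_set (snd c ` fst c)) (Top M) (chart_inv c)"
proof -
  obtain g where g: "homeomorphic_maps (subtopology (Top M) (fst c)) (top_of_set (snd c ` fst c)) (snd c) g"
    using assms homeomorphic_map_maps unfolding is_chart_def by blast
  then have "continuous_map (top_of_set (snd c ` fst c)) (Top M) g"
    using continuous_map_in_subtopology unfolding homeomorphic_maps_def by blast
  moreover have eq: "g y = chart_inv c y" if y: "y \<in> snd c ` fst c" for y
  proof -
    obtain p where p: "p \<in> fst c" "y = snd c p" using y by blast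
    then have "g y = p"
      using g chart_domain_subset[OF assms] unfolding homeomorphic_maps_def by auto
    then show ?thesis using chart_inv_left[OF assms p(1)] p(2) by simp
  qed
  ultimately show ?thesis
    by (rule continuous_map_eq) (simp add: eq)
qed

lemma open_chart_image:
  assumes "is_chart M c" "openin (Top M) U"
  shows "open (snd c ` (fst c \<inter> U))"
proof -
  have "open_map (subtopology (Top M) (fst c)) (top_of_set (snd c ` fst c)) (snd c)"
    using assms(1) homeomorphic_imp_open_map unfolding is_chart_def by blast
  moreover have "openin (subtopology (Top M) (fst c)) (fst c \<inter> U)"
    using assms(2) openin_subtopology_Int2 by blast
  ultimately have "openin (top_of_set (snd c ` fst c)) (snd c ` (fst c \<inter> U))"
    unfolding open_map_def by blast
  then show ?thesis
    using assms(1) openin_open_eq unfolding is_chart_def by blast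
qed

lemma open_chart_overlap:
  assumes "c \<in> smooth_charts M" "d \<in> smooth_charts M"
  shows "open (snd c ` (fst c \<inter> fst d))"
  using assms open_chart_image[of M c "fst d"] by (simp add: smooth_charts_def is_chart_def)

lemma open_chart_range: "c \<in> smooth_charts M \<Longrightarrow> open (snd c ` fst c)"
  by (simp add: smooth_charts_def is_chart_def)

lemma openin_chart_vimage:
  assumes "is_chart M c" "open W"
  shows "openin (Top M) {p \<in> fst c. snd c p \<in> W}"
proof -
  have "openin (subtopology (Top M) (fst c)) {p \<in> topspace (subtopology (Top M) (fst c)). snd c p \<in> W}"
    using continuous_map_chart[OF assms(1)] assms(2) openin_continuous_map_preimage by fastforce
  moreover have "topspace (subtopology (Top M) (fst c)) = fst c"
    using chart_domain_subset[OF assms(1)] by auto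
  moreover have "openin (Top M) (fst c)" using assms(1) by (simp add: is_chart_def)
  ultimately show ?thesis using openin_trans_full by fastforce
qed

lemma chart_inv_image:
  assumes "is_chart M c" "W \<subseteq> snd c ` fst c"
  shows "chart_inv c ` W = {p \<in> fst c. snd c p \<in> W}"
proof
  show "chart_inv c ` W \<subseteq> {p \<in> fst c. snd c p \<in> W}"
  proof
    fix p assume "p \<in> chart_inv c ` W"
    then obtain y where y: "y \<in> W" "p = chart_inv c y" by auto
    then have "y \<in> snd c ` fst c" using assms(2) by auto
    from chart_inv_in[OF this] chart_inv_right[OF this]
    show "p \<in> {p \<in> fst c. snd c p \<in> W}" using y by simp
  qed
  show "{p \<in> fst c. snd c p \<in> W} \<subseteq> chart_inv c ` W"
  proof
    fix p assume p: "p \<in> {p \<in> fst c. snd c p \<in> W}"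
    then have "p = chart_inv c (snd c p)" using chart_inv_left[OF assms(1)] by simp
    then show "p \<in> chart_inv c ` W" using p by blast
  qed
qed

lemma transition_chart: "is_chart M c \<Longrightarrow> p \<in> fst c \<Longrightarrow> transition c d (snd c p) = snd d p"
  by (simp add: transition_def chart_inv_left)

lemma smooth_transition_atlas:
  assumes "c \<in> smooth_charts M" "d \<in> Atlas M"
  shows "smooth_on (snd c ` (fst c \<inter> fst d)) (transition c d)"
    "smooth_on (snd d ` (fst c \<inter> fst d)) (transition d c)"
  using assms by (auto simp: smooth_charts_def compatible_def)

lemma atlas_subset_smooth_charts: "smooth_manifold M \<Longrightarrow> Atlas M \<subseteq> smooth_charts M"
  by (auto simp: smooth_manifold_def smooth_charts_def)

text \<open>Compatibility is required only with the charts of the given atlas; near each point the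
  transition between two arbitrary smooth charts factors through one of them.\<close>

lemma smooth_transition:
  assumes "smooth_manifold M" "c \<in> smooth_charts M" "d \<in> smooth_charts M"
  shows "smooth_on (snd c ` (fst c \<inter> fst d)) (transition c d)"
proof (rule smooth_on_local)
  show op: "open (snd c ` (fst c \<inter> fst d))" using open_chart_overlap assms by blast
  note c = smooth_chart_is_chart[OF assms(2)]
  fix y assume "y \<in> snd c ` (fst c \<inter> fst d)"
  then obtain p where p: "p \<in> fst c" "p \<in> fst d" "y = snd c p" by auto
  then have "p \<in> topspace (Top M)" using chart_domain_subset[OF c] by auto
  then obtain e where e: "e \<in> Atlas M" "p \<in> fst e"
    using assms(1) unfolding smooth_manifold_def by blast
  have e': "e \<in> smooth_charts M" using e(1) atlas_subset_smooth_charts[OF assms(1)] by auto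
  note ec = smooth_chart_is_chart[OF e']
  define T where "T = snd c ` (fst c \<inter> (fst d \<inter> fst e))"
  have T: "open T"
    unfolding T_def using assms(3) e' by (intro open_chart_image[OF c] openin_Int)
      (auto simp: smooth_charts_def is_chart_def)
  have "smooth_on T (\<lambda>y. transition e d (transition c e y))"
  proof (rule smooth_on_compose[OF T open_chart_overlap[OF e' assms(3)],
        where f = "transition c e" and g = "transition e d"])
    show "smooth_on T (transition c e)"
      by (rule smooth_on_subset[OF smooth_transition_atlas(1)[OF assms(2) e(1)]]) (auto simp: T_def)
    show "smooth_on (snd e ` (fst e \<inter> fst d)) (transition e d)"
      using smooth_transition_atlas(2)[OF assms(3) e(1)] by (simp add: Int_commute)
    show "transition c e ` T \<subseteq> snd e ` (fst e \<inter> fst d)"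
      by (auto simp: T_def transition_chart[OF c])
  qed
  then have "smooth_on T (transition c d)"
    by (rule smooth_on_cong[OF T, rotated])
       (auto simp: T_def transition_chart[OF c] transition_chart[OF ec])
  then have "smooth_on (T \<inter> snd c ` (fst c \<inter> fst d)) (transition c d)"
    by (rule smooth_on_subset) auto
  then show "\<exists>T. open T \<and> y \<in> T \<and> smooth_on (T \<inter> snd c ` (fst c \<inter> fst d)) (transition c d)"
    using T p e by (intro exI[of _ T]) (auto simp: T_def)
qed

text \<open>The only way in which new coordinate systems are produced below: shrink a smooth chart and
  follow it by a diffeomorphism between open sets of \<open>\<real>\<^sup>n\<close>.\<close>

lemma chart_compose_diffeo:
  assumes M: "smooth_manifold M" and c: "c \<in> smooth_charts M"
    and W: "open W" "W \<subseteq> snd c ` fst c" and f: "smooth_on W f" "open (f ` W)"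
    and g: "smooth_on (f ` W) g" "\<And>x. x \<in> W \<Longrightarrow> g (f x) = x"
  shows "(chart_inv c ` W, f \<circ> snd c) \<in> smooth_charts M"
proof -
  let ?U = "chart_inv c ` W" and ?h = "f \<circ> snd c"
  note cc = smooth_chart_is_chart[OF c]
  note U = chart_inv_image[OF cc W(2)]
  have oU: "openin (Top M) ?U" unfolding U by (rule openin_chart_vimage[OF cc W(1)])
  have right: "snd c (chart_inv c y) = y" if "y \<in> W" for y
    using chart_inv_right[of y c] W(2) that by blast
  have cU: "snd c ` ?U = W" by (simp add: image_image right)
  have hU: "?h ` ?U = f ` W" unfolding image_comp[symmetric] cU ..
  have tU: "topspace (subtopology (Top M) ?U) = ?U"
    using openin_subset[OF oU] by auto
  have "homeomorphic_maps (subtopology (Top M) ?U) (top_of_set (f ` W)) ?h (chart_inv c \<circ> g)"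
    unfolding homeomorphic_maps_def
  proof (intro conjI ballI)
    have 1: "continuous_map (subtopology (Top M) ?U) (top_of_set W) (snd c)"
      unfolding continuous_map_in_subtopology
      using continuous_map_from_subtopology_mono[OF continuous_map_chart[OF cc], of ?U] U cU tU by auto
    have 2: "continuous_map (top_of_set W) (top_of_set (f ` W)) f"
      using smooth_on_continuous[OF f(1)] by (simp add: continuous_map_in_subtopology image_subset_iff)
    show "continuous_map (subtopology (Top M) ?U) (top_of_set (f ` W)) ?h"
      using 1 2 by (rule continuous_map_compose)
    have 3: "continuous_map (top_of_set (f ` W)) (top_of_set (snd c ` fst c)) g"
      using smooth_on_continuous[OF g(1)] g(2) W(2) by (auto simp: continuous_map_in_subtopology)
    have "continuous_map (top_of_set (f ` W)) (Top M) (chart_inv c \<circ> g)"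
      by (rule continuous_map_compose[OF 3 continuous_map_chart_inv[OF cc]])
    then show "continuous_map (top_of_set (f ` W)) (subtopology (Top M) ?U) (chart_inv c \<circ> g)"
      using g(2) by (auto simp: continuous_map_in_subtopology)
    show "(chart_inv c \<circ> g) (?h p) = p" if "p \<in> topspace (subtopology (Top M) ?U)" for p
      using that g(2) chart_inv_left[OF cc] unfolding tU unfolding U by auto
    show "?h ((chart_inv c \<circ> g) y) = y" if "y \<in> topspace (top_of_set (f ` W))" for y
      using that g(2) right by auto
  qed
  then have "homeomorphic_map (subtopology (Top M) ?U) (top_of_set (f ` W)) ?h"
    using homeomorphic_map_maps by blast
  then have chart: "is_chart M (?U, ?h)"
    using oU hU f(2) by (simp add: is_chart_def)
  have "compatible (?U, ?h) d" if d: "d \<in> Atlas M" for d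
  proof -
    have d': "d \<in> smooth_charts M" using d atlas_subset_smooth_charts[OF M] by auto
    note dc = smooth_chart_is_chart[OF d']
    have Uc: "?U \<subseteq> fst c" unfolding U by auto
    have od: "openin (Top M) (fst d)" using dc by (simp add: is_chart_def)
    have o1: "open (?h ` (?U \<inter> fst d))" using open_chart_image[OF chart od] by simp
    have o2: "open (snd d ` (?U \<inter> fst d))"
      using open_chart_image[OF dc oU] by (simp add: Int_commute)
    have sub: "?h ` (?U \<inter> fst d) \<subseteq> f ` W" using hU by blast
    have gh: "g (?h p) = snd c p" if "p \<in> ?U" for p
      using that g(2) unfolding U by auto
    have "smooth_on (?h ` (?U \<inter> fst d)) (\<lambda>y. transition c d (g y))"
    proof (rule smooth_on_compose[OF o1 open_chart_overlap[OF c d']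
          smooth_on_subset[OF g(1) sub] smooth_transition[OF M c d']])
      show "g ` ?h ` (?U \<inter> fst d) \<subseteq> snd c ` (fst c \<inter> fst d)"
        using gh Uc by auto
    qed
    then have "smooth_on (?h ` (?U \<inter> fst d)) (transition (?U, ?h) d)"
    proof (rule smooth_on_cong[OF o1, rotated])
      fix y assume "y \<in> ?h ` (?U \<inter> fst d)"
      then obtain p where p: "p \<in> ?U" "y = ?h p" by auto
      have "transition (?U, ?h) d y = snd d p"
        using transition_chart[OF chart, of p d] p by simp
      moreover have "transition c d (g y) = snd d p"
        using p Uc gh transition_chart[OF cc, of p d] by auto
      ultimately show "transition c d (g y) = transition (?U, ?h) d y" by simp
    qed
    moreover have "smooth_on (snd d ` (?U \<inter> fst d)) (\<lambda>y. f (transition d c y))"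
    proof (rule smooth_on_compose[OF o2 W(1) _ f(1)])
      show "smooth_on (snd d ` (?U \<inter> fst d)) (transition d c)"
        by (rule smooth_on_subset[OF smooth_transition[OF M d' c]]) (use Uc in auto)
      show "transition d c ` snd d ` (?U \<inter> fst d) \<subseteq> W"
        unfolding U by (auto simp: transition_chart[OF dc])
    qed
    then have "smooth_on (snd d ` (?U \<inter> fst d)) (transition d (?U, ?h))"
      by (simp add: transition_def o_def)
    ultimately show ?thesis by (simp add: compatible_def)
  qed
  then show ?thesis using chart by (simp add: smooth_charts_def)
qed

section \<open>Tangent vectors and forms in charts\<close>

lemma transition_has_derivative:
  assumes "smooth_manifold M" "c \<in> charts_at M p" "d \<in> charts_at M p"
  shows "(transition c d has_derivative frechet_derivative (transition c d) (at (snd c p))) (at (snd c p))"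
  using charts_atD[OF assms(2)] charts_atD[OF assms(3)]
  by (intro smooth_on_derivative[OF smooth_transition[OF assms(1)]]) auto

text \<open>The chain rule for transition maps; it makes the description of tangent vectors by one chart
  independent of that chart.\<close>

lemma transition_derivative_compose:
  assumes M: "smooth_manifold M" and c: "c \<in> charts_at M p" and d: "d \<in> charts_at M p"
    and e: "e \<in> charts_at M p"
  shows "frechet_derivative (transition c e) (at (snd c p)) u =
    frechet_derivative (transition d e) (at (snd d p)) (frechet_derivative (transition c d) (at (snd c p)) u)"
proof -
  note cc = smooth_chart_is_chart[OF charts_atD(1)[OF c]] and dd = smooth_chart_is_chart[OF charts_atD(1)[OF d]]
  have "(transition d e has_derivative frechet_derivative (transition d e) (at (snd d p)))
      (at (transition c d (snd c p)))"
    using transition_has_derivative[OF M d e] transition_chart[OF cc charts_atD(2)[OF c]] by simp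
  then have "((\<lambda>y. transition d e (transition c d y)) has_derivative
      (\<lambda>u. frechet_derivative (transition d e) (at (snd d p))
        (frechet_derivative (transition c d) (at (snd c p)) u))) (at (snd c p))"
    using has_derivative_compose[OF transition_has_derivative[OF M c d]] by blast
  then have "(transition c e has_derivative
      (\<lambda>u. frechet_derivative (transition d e) (at (snd d p))
        (frechet_derivative (transition c d) (at (snd c p)) u))) (at (snd c p))"
  proof (rule has_derivative_transform_within_open[OF _ open_chart_overlap])
    show "c \<in> smooth_charts M" "d \<in> smooth_charts M" "snd c p \<in> snd c ` (fst c \<inter> fst d)"
      using charts_atD[OF c] charts_atD[OF d] by auto
    show "transition d e (transition c d y) = transition c e y" if "y \<in> snd c ` (fst c \<inter> fst d)" for y
      using that by (auto simp: transition_chart[OF cc] transition_chart[OF dd])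
  qed
  then show ?thesis by (simp add: frechet_derivative_at[symmetric])
qed

lemma transition_derivative_self:
  assumes "c \<in> charts_at M p"
  shows "frechet_derivative (transition c c) (at (snd c p)) u = u"
proof -
  note c = charts_atD(1)[OF assms]
  have "(transition c c has_derivative (\<lambda>u. u)) (at (snd c p))"
    by (rule has_derivative_transform_within_open[OF has_derivative_ident open_chart_range[OF c]])
       (use charts_atD(2)[OF assms] in \<open>auto simp: transition_chart[OF smooth_chart_is_chart[OF c]]\<close>)
  then show ?thesis by (simp add: frechet_derivative_at[symmetric])
qed

lemma chart_inv_diff_eq:
  assumes "c \<in> charts_at M p"
  shows "chart_inv_diff M c (snd c p) u =
    (\<lambda>d. if d \<in> charts_at M p then frechet_derivative (transition c d) (at (snd c p)) u else 0)"
  using chart_inv_left[OF smooth_chart_is_chart[OF charts_atD(1)[OF assms]] charts_atD(2)[OF assms]]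
  by (simp add: chart_inv_diff_def)

lemma chart_inv_diff_tangent:
  assumes "smooth_manifold M" "c \<in> charts_at M p"
  shows "chart_inv_diff M c (snd c p) u \<in> tangent_space M p"
proof -
  let ?D = "\<lambda>d. frechet_derivative (transition c d) (at (snd c p)) u"
  have D: "?D e = frechet_derivative (transition d e) (at (snd d p)) (?D d)"
    if "d \<in> charts_at M p" "e \<in> charts_at M p" for d e
    by (rule transition_derivative_compose[OF assms that])
  show ?thesis
    unfolding chart_inv_diff_eq[OF assms(2)] tangent_space_def mem_Collect_eq
  proof (intro conjI ballI allI impI, unfold if_P)
    fix d e assume "d \<in> charts_at M p" "e \<in> charts_at M p"
    then show "?D e = frechet_derivative (transition d e) (at (snd d p)) (?D d)" by (rule D)
  qed simp
qed

text \<open>A tangent vector is determined by its representative in a single chart.\<close>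

lemma tangent_eq_chart_inv_diff:
  assumes "v \<in> tangent_space M p" "c \<in> charts_at M p"
  shows "chart_inv_diff M c (snd c p) (v c) = v"
proof
  fix d
  show "chart_inv_diff M c (snd c p) (v c) d = v d"
    unfolding chart_inv_diff_eq[OF assms(2)]
  proof (cases "d \<in> charts_at M p")
    case True
    then have "v d = frechet_derivative (transition c d) (at (snd c p)) (v c)"
      using assms unfolding tangent_space_def by blast
    then show "(if d \<in> charts_at M p then frechet_derivative (transition c d) (at (snd c p)) (v c)
        else 0) = v d" using True by simp
  next
    case False
    then have "v d = 0" using assms(1) unfolding tangent_space_def by blast
    then show "(if d \<in> charts_at M p then frechet_derivative (transition c d) (at (snd c p)) (v c)
        else 0) = v d" using False by simp
  qed
qed

lemma chart_inv_diff_change: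
  assumes "smooth_manifold M" "c \<in> charts_at M p" "d \<in> charts_at M p"
  shows "chart_inv_diff M c (snd c p) u =
    chart_inv_diff M d (snd d p) (frechet_derivative (transition c d) (at (snd c p)) u)"
  unfolding chart_inv_diff_eq[OF assms(2)] chart_inv_diff_eq[OF assms(3)]
  using transition_derivative_compose[OF assms] by auto

lemma chart_inv_diff_linear:
  assumes "smooth_manifold M" "c \<in> charts_at M p"
  shows "chart_inv_diff M c (snd c p) (r *\<^sub>R x + s *\<^sub>R y) =
    (\<lambda>d. r *\<^sub>R chart_inv_diff M c (snd c p) x d + s *\<^sub>R chart_inv_diff M c (snd c p) y d)"
proof -
  have "linear (frechet_derivative (transition c d) (at (snd c p)))" if "d \<in> charts_at M p" for d
    using transition_has_derivative[OF assms that] has_derivative_linear by blast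
  then show ?thesis
    unfolding chart_inv_diff_eq[OF assms(2)] by (auto simp: fun_eq_iff linear_add linear_cmul)
qed

lemma push_form_chart:
  assumes "c \<in> charts_at M p"
  shows "push_form M c \<omega> (snd c p) u = \<omega> p (\<lambda>i. chart_inv_diff M c (snd c p) (u i))"
  using chart_inv_left[OF smooth_chart_is_chart[OF charts_atD(1)[OF assms]] charts_atD(2)[OF assms]]
  by (simp add: push_form_def)

lemma push_form_change:
  assumes "smooth_manifold M" "c \<in> charts_at M p" "d \<in> charts_at M p"
  shows "push_form M c \<omega> (snd c p) u =
    push_form M d \<omega> (snd d p) (\<lambda>i. frechet_derivative (transition c d) (at (snd c p)) (u i))"
  unfolding push_form_chart[OF assms(2)] push_form_chart[OF assms(3)] chart_inv_diff_change[OF assms] ..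

text \<open>A top-degree form has one degree of freedom per point, so in a chart it is known once its
  density, the value on the standard basis, is known.\<close>

lemma push_form_eq_std_volume:
  assumes M: "smooth_manifold M" and c: "c \<in> charts_at M p" and "alternating_form_at M p (\<omega> p)"
  shows "push_form M c \<omega> (snd c p) u = std_volume u * push_form M c \<omega> (snd c p) (\<lambda>i. axis i 1)"
proof (rule alternating_form_eq_std_volume)
  let ?T = "\<lambda>u. chart_inv_diff M c (snd c p) u"
  have T: "?T x \<in> tangent_space M p" for x by (rule chart_inv_diff_tangent[OF M c])
  have upd: "(\<lambda>k. ?T ((u(i := x)) k)) = (\<lambda>k. ?T (u k))(i := ?T x)" for u :: "'b \<Rightarrow> real ^ 'b" and i x
    by auto
  show "push_form M c \<omega> (snd c p) (u(i := r *\<^sub>R x + s *\<^sub>R y)) =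
      r * push_form M c \<omega> (snd c p) (u(i := x)) + s * push_form M c \<omega> (snd c p) (u(i := y))"
    for u i x y r s
    unfolding push_form_chart[OF c] upd chart_inv_diff_linear[OF M c]
    using assms(3) T by (simp add: alternating_form_at_def)
  show "push_form M c \<omega> (snd c p) u = 0" if "i \<noteq> j" "u i = u j" for u i j
    unfolding push_form_chart[OF c]
  proof -
    let ?v = "\<lambda>k. ?T (u k)"
    have "i \<noteq> j \<and> ?v i = ?v j" using that by simp
    then show "\<omega> p ?v = 0"
      using assms(3)[unfolded alternating_form_at_def, rule_format, of ?v, OF T] by blast
  qed
qed

text \<open>If the density vanished at a point, the whole form would vanish there.\<close>

lemma push_form_basis_nonzero:
  assumes M: "smooth_manifold M" and c: "c \<in> charts_at M p" and "volume_form M \<omega>"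
  shows "push_form M c \<omega> (snd c p) (\<lambda>i. axis i 1) \<noteq> 0"
proof -
  have "p \<in> topspace (Top M)"
    using chart_domain_subset[OF smooth_chart_is_chart[OF charts_atD(1)[OF c]]] charts_atD(2)[OF c] by auto
  then obtain v where alt: "alternating_form_at M p (\<omega> p)"
    and v: "\<And>i. v i \<in> tangent_space M p" "\<omega> p v \<noteq> 0"
    using assms(3) unfolding volume_form_def by blast
  have "push_form M c \<omega> (snd c p) (\<lambda>i. v i c) = \<omega> p v"
    unfolding push_form_chart[OF c] tangent_eq_chart_inv_diff[OF v(1) c] ..
  then show ?thesis
    using v(2) push_form_eq_std_volume[OF M c, of \<omega> "\<lambda>i. v i c"] alt by auto
qed

section \<open>Flow boxes\<close>

lemma flow_zero: "flow_of M X \<phi> \<Longrightarrow> p \<in> topspace (Top M) \<Longrightarrow> \<phi> 0 p = p"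
  by (simp add: flow_of_def)

lemma flow_add: "flow_of M X \<phi> \<Longrightarrow> p \<in> topspace (Top M) \<Longrightarrow> \<phi> s (\<phi> t p) = \<phi> (s + t) p"
  by (simp add: flow_of_def)

lemma field_eq_flow_derivative:
  assumes "flow_of M X \<phi>" "d \<in> charts_at M p"
  shows "X p d = vector_derivative (\<lambda>s. snd d (\<phi> s p)) (at 0)"
proof -
  have p: "p \<in> topspace (Top M)"
    using chart_domain_subset[OF smooth_chart_is_chart] charts_atD[OF assms(2)] by blast
  then have "velocity M (\<lambda>s. \<phi> s p) 0 d = X (\<phi> 0 p) d"
    using assms(1) unfolding flow_of_def by simp
  then show ?thesis
    using flow_zero[OF assms(1) p] assms(2) by (simp add: velocity_def o_def)
qed

lemma open_flow_domain:
  assumes "flow_of M X \<phi>" "c \<in> smooth_charts M" "d \<in> smooth_charts M"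
  shows "open {(t, y). y \<in> snd c ` fst c \<and> \<phi> t (chart_inv c y) \<in> fst d}"
proof -
  let ?S = "(UNIV :: real set) \<times> snd c ` fst c"
  have "continuous_map (top_of_set ?S) euclidean fst"
    by (simp add: continuous_on_fst)
  moreover have "continuous_map (top_of_set ?S) (Top M) (chart_inv c \<circ> snd)"
    by (rule continuous_map_compose[OF _ continuous_map_chart_inv[OF smooth_chart_is_chart[OF assms(2)]]])
       (auto simp: continuous_map_in_subtopology continuous_on_snd)
  ultimately have 1: "continuous_map (top_of_set ?S) (prod_topology euclidean (Top M))
      (\<lambda>z. (fst z, (chart_inv c \<circ> snd) z))"
    by (simp add: continuous_map_paired o_def)
  have "continuous_map (prod_topology euclidean (Top M)) (Top M) (\<lambda>(t, p). \<phi> t p)"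
    using assms(1) by (simp add: flow_of_def)
  from continuous_map_compose[OF 1 this]
  have "continuous_map (top_of_set ?S) (Top M) (\<lambda>z. \<phi> (fst z) (chart_inv c (snd z)))"
    by (simp add: o_def)
  then have "openin (top_of_set ?S)
      {z \<in> topspace (top_of_set ?S). \<phi> (fst z) (chart_inv c (snd z)) \<in> fst d}"
    using smooth_chart_is_chart[OF assms(3)]
    by (intro openin_continuous_map_preimage) (auto simp: is_chart_def)
  moreover have "open ?S" using open_chart_range[OF assms(2)] by (simp add: open_Times)
  ultimately have "open {z \<in> topspace (top_of_set ?S). \<phi> (fst z) (chart_inv c (snd z)) \<in> fst d}"
    using openin_open_eq by blast
  moreover have "{z \<in> topspace (top_of_set ?S). \<phi> (fst z) (chart_inv c (snd z)) \<in> fst d} =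
      {(t, y). y \<in> snd c ` fst c \<and> \<phi> t (chart_inv c y) \<in> fst d}"
    by auto
  ultimately show ?thesis by simp
qed

text \<open>The linear map is determined by its restrictions to the two factors: the time-zero map is
  the identity, and the orbit through \<open>p\<close> has velocity \<open>X p\<close>.\<close>

lemma flow_chart_derivative:
  assumes M: "smooth_manifold M" and flow: "flow_of M X \<phi>" and c: "c \<in> charts_at M p"
  shows "((\<lambda>(t, y). snd c (\<phi> t (chart_inv c y))) has_derivative (\<lambda>(s, v). s *\<^sub>R X p c + v))
    (at (0, snd c p))"
proof -
  let ?E = "{(t, y). y \<in> snd c ` fst c \<and> \<phi> t (chart_inv c y) \<in> fst c}"
  let ?F = "\<lambda>(t, y). snd c (\<phi> t (chart_inv c y))"
  note c' = charts_atD(1)[OF c] and pc = charts_atD(2)[OF c]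
  note cc = smooth_chart_is_chart[OF c']
  have F0: "?F (0, y) = y" if "y \<in> snd c ` fst c" for y
  proof -
    have "chart_inv c y \<in> topspace (Top M)"
      using chart_inv_in[OF that] chart_domain_subset[OF cc] by auto
    then show ?thesis using flow_zero[OF flow] chart_inv_right[OF that] by simp
  qed
  have "smooth_on ?E ?F" using flow c' unfolding flow_of_def by blast
  moreover have "p \<in> topspace (Top M)" using pc chart_domain_subset[OF cc] by auto
  then have "(0, snd c p) \<in> ?E"
    using pc chart_inv_left[OF cc pc] flow_zero[OF flow] by simp
  ultimately have D: "(?F has_derivative frechet_derivative ?F (at (0, snd c p))) (at (0, snd c p))"
    (is "(_ has_derivative ?D) _")
    by (rule smooth_on_derivative)
  have D': "(?F has_derivative ?D) (at ((\<lambda>y. (0, y)) (snd c p)))" using D by simp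
  have "((\<lambda>y. ?F (0, y)) has_derivative (\<lambda>v. ?D (0, v))) (at (snd c p))"
    by (rule has_derivative_compose[where f = "\<lambda>y. (0, y)" and g = ?F, OF _ D']) (auto intro!: derivative_eq_intros)
  then have "((\<lambda>y. y) has_derivative (\<lambda>v. ?D (0, v))) (at (snd c p))"
    by (rule has_derivative_transform_within_open[OF _ open_chart_range[OF c']]) (use pc F0 in auto)
  from has_derivative_unique[OF this has_derivative_ident]
  have Dv: "?D (0, v) = v" for v by (rule fun_cong)
  have D'': "(?F has_derivative ?D) (at ((\<lambda>s. (s, snd c p)) (0::real)))" using D by simp
  have lin: "linear ?D" using D has_derivative_linear by blast
  have "((\<lambda>s. ?F (s, snd c p)) has_derivative (\<lambda>s. ?D (s, 0))) (at 0)"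
    by (rule has_derivative_compose[where f = "\<lambda>s. (s, snd c p)" and g = ?F, OF _ D'']) (auto intro!: derivative_eq_intros)
  moreover have "(\<lambda>s. ?D (s, 0)) = (\<lambda>s. s *\<^sub>R ?D (1, 0))"
  proof
    fix s
    have "?D (s, 0) = ?D (s *\<^sub>R (1, 0))" by simp
    also have "\<dots> = s *\<^sub>R ?D (1, 0)" by (rule linear_cmul[OF lin])
    finally show "?D (s, 0) = s *\<^sub>R ?D (1, 0)" .
  qed
  ultimately have "((\<lambda>s. snd c (\<phi> s p)) has_vector_derivative ?D (1, 0)) (at 0)"
    unfolding has_vector_derivative_def by (simp only: case_prod_conv chart_inv_left[OF cc pc])
  then have X: "X p c = ?D (1, 0)"
    unfolding field_eq_flow_derivative[OF flow c] by (rule vector_derivative_at)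
  have "?D (s, v) = s *\<^sub>R X p c + v" for s v
  proof -
    have "?D (s, v) = ?D (s *\<^sub>R (1, 0) + (0, v))" by simp
    also have "\<dots> = s *\<^sub>R ?D (1, 0) + ?D (0, v)"
      unfolding linear_add[OF lin] linear_cmul[OF lin] ..
    finally show ?thesis unfolding Dv X .
  qed
  then have "?D = (\<lambda>(s, v). s *\<^sub>R X p c + v)" by auto
  then show ?thesis using D by simp
qed

text \<open>In a slice chart, curves in the hypersurface have velocities with last coordinate \<open>0\<close>.  If
  \<open>X a\<close> had this property too, the last basis vector would not be in the span of \<open>X a\<close> and
  the tangent space of the hypersurface.\<close>

lemma transversal_component_nonzero:
  fixes M :: "('a, 'n::{finite, linorder}) manifold"
  assumes M: "smooth_manifold M" and trans: "transversal_section M X S" and "a \<in> S"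
    and c: "c \<in> charts_at M a"
    and slice: "snd c ` (fst c \<inter> S) = {y \<in> snd c ` fst c. y $ last_index = 0}"
  shows "X a c $ last_index \<noteq> 0"
proof -
  let ?L = "last_index :: 'n" and ?v = "chart_inv_diff M c (snd c a) (axis last_index 1)"
  have "?v \<in> tangent_space M a" by (rule chart_inv_diff_tangent[OF M c])
  then obtain w r where w: "w \<in> tangent_space_of_subset M S a" and v: "?v = (\<lambda>c. w c + r *\<^sub>R X a c)"
    using trans \<open>a \<in> S\<close> unfolding transversal_section_def by blast
  have "?v c = axis ?L 1"
    using c transition_derivative_self[OF c] by (simp add: chart_inv_diff_eq[OF c])
  then have "w c + r *\<^sub>R X a c = axis ?L 1" using fun_cong[OF v, of c] by simp
  from arg_cong[OF this, of "\<lambda>y. y $ ?L"]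
  have 1: "w c $ ?L + r * X a c $ ?L = 1" by simp
  obtain \<gamma> \<epsilon> where \<gamma>: "w = velocity M \<gamma> 0" "\<epsilon> > 0" "smooth_curve M {-\<epsilon><..<\<epsilon>} \<gamma>"
      "\<gamma> ` {-\<epsilon><..<\<epsilon>} \<subseteq> S" "\<gamma> 0 = a"
    using w unfolding tangent_space_of_subset_def by blast
  let ?I = "{t \<in> {-\<epsilon><..<\<epsilon>}. \<gamma> t \<in> fst c}"
  have "openin (Top M) (fst c)"
    using smooth_chart_is_chart[OF charts_atD(1)[OF c]] by (simp add: is_chart_def)
  then have "openin (top_of_set {-\<epsilon><..<\<epsilon>}) ?I"
    using \<gamma>(3) openin_continuous_map_preimage[of "top_of_set {-\<epsilon><..<\<epsilon>}" "Top M" \<gamma> "fst c"]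
    by (simp add: smooth_curve_def)
  then have I: "open ?I" using openin_open_eq[of "{-\<epsilon><..<\<epsilon>}" ?I] by auto
  have 0: "0 \<in> ?I" using \<gamma>(2,5) charts_atD(2)[OF c] by simp
  have "smooth_on ?I (snd c \<circ> \<gamma>)"
    using \<gamma>(3) charts_atD(1)[OF c] unfolding smooth_curve_def by blast
  from smooth_on_derivative[OF this 0]
  have "(snd c \<circ> \<gamma>) differentiable (at 0)" by (auto simp: differentiable_def)
  then have "((snd c \<circ> \<gamma>) has_vector_derivative vector_derivative (snd c \<circ> \<gamma>) (at 0)) (at 0)"
    by (simp add: vector_derivative_works)
  moreover have "vector_derivative (snd c \<circ> \<gamma>) (at 0) = w c"
    using \<gamma>(1,5) c by (simp add: velocity_def)
  ultimately have "((snd c \<circ> \<gamma>) has_vector_derivative w c) (at 0)" by simp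
  from bounded_linear.has_vector_derivative[OF bounded_linear_vec_nth this]
  have der: "((\<lambda>t. (snd c \<circ> \<gamma>) t $ ?L) has_vector_derivative w c $ ?L) (at 0)" .
  have vanish: "(snd c \<circ> \<gamma>) t $ ?L = 0" if "t \<in> ?I" for t
  proof -
    have "\<gamma> t \<in> fst c \<inter> S" using that \<gamma>(4) by auto
    then have "snd c (\<gamma> t) \<in> {y \<in> snd c ` fst c. y $ ?L = 0}" using slice by blast
    then show ?thesis by simp
  qed
  have "((\<lambda>t. 0) has_vector_derivative w c $ ?L) (at (0::real))"
    by (rule has_vector_derivative_transform_within_open[OF der I 0 vanish])
  from vector_derivative_at[OF this] have "w c $ ?L = 0" by simp
  then show ?thesis using 1 by auto
qed

text \<open>The box is parametrised by starting on the slice and following the flow for the time given by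
  the last coordinate: in a slice chart this is a smooth map \<open>G\<close>, whose derivative at the origin
  is the identity on the slice directions and sends the last basis vector to \<open>X a\<close>.  This is
  injective by transversality, so \<open>G\<close> is a local diffeomorphism.  In the coordinates \<open>G\<inverse>\<close> the
  flow is a translation by the group property.\<close>

theorem transversal_flow_box:
  fixes M :: "('a, 'n::{finite, linorder}) manifold"
  assumes M: "smooth_manifold M" and flow: "flow_of M X \<phi>"
    and trans: "transversal_section M X S" and a: "a \<in> S"
  obtains b r where "b \<in> charts_at M a" "snd b a = 0" "r > 0" "snd b ` fst b = ball 0 r"
    "\<And>x t. x \<in> ball 0 r \<Longrightarrow> x + t *\<^sub>R axis last_index 1 \<in> ball 0 r \<Longrightarrow>
      \<phi> t (chart_inv b x) = chart_inv b (x + t *\<^sub>R axis last_index 1)"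
    "\<And>p. p \<in> fst b \<inter> S \<Longrightarrow> snd b p $ last_index = 0"
proof -
  let ?L = "last_index :: 'n"
  obtain c where c: "c \<in> charts_at M a"
    and slice: "snd c ` (fst c \<inter> S) = {y \<in> snd c ` fst c. y $ ?L = 0}"
    using trans a unfolding transversal_section_def embedded_hypersurface_def by blast
  note c' = charts_atD(1)[OF c] and ac = charts_atD(2)[OF c]
  note cc = smooth_chart_is_chart[OF c']
  define y0 where "y0 = snd c a"
  have "y0 \<in> snd c ` (fst c \<inter> S)" using ac a by (simp add: y0_def)
  then have y0: "y0 $ ?L = 0" "y0 \<in> snd c ` fst c" unfolding slice by auto
  let ?E = "{(t, y). y \<in> snd c ` fst c \<and> \<phi> t (chart_inv c y) \<in> fst c}"
  let ?F = "\<lambda>(t, y). snd c (\<phi> t (chart_inv c y))"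
  define proj where "proj x = x - (x $ ?L) *\<^sub>R axis ?L 1" for x :: "(real, 'n) vec"
  \<comment> \<open>Elapsed time and starting point for the point with coordinates \<open>x\<close>; the slice passes
      through \<open>y0\<close>, which is moved to the origin.\<close>
  define J where "J x = (x $ ?L, proj x + y0)" for x :: "(real, 'n) vec"
  define G where "G x = ?F (J x)" for x
  define D where "D = J -` ?E"
  have proj: "bounded_linear proj"
    unfolding proj_def by (intro bounded_linear_intros bounded_linear_vec_nth)
  have "bounded_linear (\<lambda>x :: (real, 'n) vec. (x $ ?L, proj x))"
    by (intro bounded_linear_Pair bounded_linear_vec_nth proj)
  from smooth_on_add[OF open_UNIV smooth_on_bounded_linear[OF this] smooth_on_const[of UNIV "(0, y0)"]]
  have J: "smooth_on UNIV J" by (simp add: J_def[abs_def])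
  have E: "open ?E" by (rule open_flow_domain[OF flow c' c'])
  have oD: "open D"
    unfolding D_def using smooth_on_continuous[OF J] E by (intro open_vimage)
  have "smooth_on ?E ?F" using flow c' unfolding flow_of_def by blast
  then have smG: "smooth_on D G"
    unfolding G_def by (intro smooth_on_compose[OF oD E smooth_on_subset[OF J]]) (auto simp: D_def)
  have G0: "G z = z + y0" if "z $ ?L = 0" "z + y0 \<in> snd c ` fst c" for z
  proof -
    have "chart_inv c (z + y0) \<in> topspace (Top M)"
      using chart_inv_in[OF that(2)] chart_domain_subset[OF cc] by auto
    then show ?thesis
      using that(1) flow_zero[OF flow] chart_inv_right[OF that(2)] by (simp add: G_def J_def proj_def)
  qed
  have J0: "J 0 = (0, y0)" by (simp add: J_def proj_def)
  have "chart_inv c y0 = a" using chart_inv_left[OF cc ac] by (simp add: y0_def)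
  moreover have "a \<in> topspace (Top M)" using ac chart_domain_subset[OF cc] by auto
  ultimately have D0: "0 \<in> D"
    using y0 ac flow_zero[OF flow] by (simp add: D_def J0)
  have dG: "frechet_derivative G (at 0) v = v $ ?L *\<^sub>R X a c + proj v" for v
  proof -
    have "(J has_derivative (\<lambda>v. (v $ ?L, proj v))) (at 0)"
      unfolding J_def
      by (auto intro!: derivative_eq_intros bounded_linear_imp_has_derivative bounded_linear_vec_nth proj)
    moreover have "(?F has_derivative (\<lambda>(s, v). s *\<^sub>R X a c + v)) (at (J 0))"
      using flow_chart_derivative[OF M flow c] by (simp add: J0 y0_def)
    ultimately have "(G has_derivative (\<lambda>v. case (v $ ?L, proj v) of (s, v) \<Rightarrow> s *\<^sub>R X a c + v)) (at 0)"
      unfolding G_def by (rule has_derivative_compose)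
    then show ?thesis by (simp add: frechet_derivative_at[symmetric])
  qed
  have X: "X a c $ ?L \<noteq> 0" by (rule transversal_component_nonzero[OF M trans a c slice])
  have inj: "v = 0" if "frechet_derivative G (at 0) v = 0" for v
  proof -
    have 0: "v $ ?L *\<^sub>R X a c + proj v = 0" using that dG by simp
    then have "(v $ ?L *\<^sub>R X a c + proj v) $ ?L = 0" by simp
    then have "v $ ?L = 0" using X by (simp add: proj_def)
    then show "v = 0" using 0 by (simp add: proj_def)
  qed
  obtain W g where W: "open W" "W \<subseteq> D" "0 \<in> W" "open (G ` W)" "smooth_on (G ` W) g"
    and gG: "\<And>x. x \<in> W \<Longrightarrow> g (G x) = x"
    using smooth_inverse_function[OF oD smG D0 inj] by blast
  have contG: "continuous_on W G" using smooth_on_continuous[OF smooth_on_subset[OF smG W(2)]] .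
  \<comment> \<open>A point of the section in the box could a priori be reached from the slice in a nonzero
      time.  Its time-zero preimage under \<open>G\<close> is \<open>G x - y0\<close>; forcing this point into \<open>W\<close>, where
      \<open>G\<close> is injective, excludes it.\<close>
  have "open (W \<inter> (\<lambda>x. G x - y0) -` W)"
    by (intro continuous_open_preimage continuous_intros contG W(1))
  moreover have "0 \<in> W \<inter> (\<lambda>x. G x - y0) -` W" using W(3) G0[of 0] y0 by simp
  ultimately obtain r where r: "r > 0" "ball 0 r \<subseteq> W \<inter> (\<lambda>x. G x - y0) -` W"
    using openE by blast
  let ?B = "ball 0 r :: (real, 'n) vec set"
  have BW: "?B \<subseteq> W" using r(2) by auto
  have gGB: "g ` G ` ?B = ?B" using gG BW by (force simp: image_image)
  have "G ` ?B = G ` W \<inter> g -` ?B" using gG BW by force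
  then have oGB: "open (G ` ?B)"
    using continuous_open_preimage[OF smooth_on_continuous[OF W(5)] W(4) open_ball[of 0 r]] by simp
  have Gq: "\<phi> (x $ ?L) (chart_inv c (proj x + y0)) \<in> fst c" "proj x + y0 \<in> snd c ` fst c"
    if "x \<in> W" for x
    using that W(2) by (auto simp: D_def J_def)
  have Gc: "chart_inv c (G x) = \<phi> (x $ ?L) (chart_inv c (proj x + y0))" if "x \<in> W" for x
    using chart_inv_left[OF cc Gq(1)[OF that]] by (simp add: G_def J_def)
  have Grange: "G x \<in> snd c ` fst c" if "x \<in> W" for x
    using Gq(1)[OF that] by (simp add: G_def J_def)
  let ?b = "(chart_inv c ` G ` ?B, g \<circ> snd c)"
  have b: "?b \<in> smooth_charts M"
  proof (rule chart_compose_diffeo[OF M c' oGB])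
    show "G ` ?B \<subseteq> snd c ` fst c" using Grange BW by blast
    show "smooth_on (G ` ?B) g" by (rule smooth_on_subset[OF W(5)]) (use BW in auto)
    show "open (g ` G ` ?B)" "smooth_on (g ` G ` ?B) G"
      unfolding gGB using smooth_on_subset[OF smG] BW W(2) by auto
    show "G (g y) = y" if "y \<in> G ` ?B" for y using that gG BW by auto
  qed
  have cG: "snd c (chart_inv c (G x)) = G x" if "x \<in> ?B" for x
    using chart_inv_right[OF Grange] BW that by blast
  have bx: "snd ?b (chart_inv c (G x)) = x" if "x \<in> ?B" for x
    using cG[OF that] gG BW that by auto
  have binv: "chart_inv ?b x = chart_inv c (G x)" if "x \<in> ?B" for x
  proof -
    have "chart_inv c (G x) \<in> fst ?b" using that by auto
    from chart_inv_left[OF smooth_chart_is_chart[OF b] this] show ?thesis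
      using bx[OF that] by simp
  qed
  have G00: "G 0 = y0" using G0[of 0] y0 by simp
  have a_eq: "a = chart_inv c (G 0)" using \<open>chart_inv c y0 = a\<close> G00 by simp
  have 0: "0 \<in> ?B" using r(1) by simp
  show thesis
  proof (rule that[of ?b r])
    show "?b \<in> charts_at M a" using b a_eq 0 by (auto simp: charts_at_def)
    show "snd ?b a = 0" using bx[OF 0] a_eq by simp
    show "r > 0" by (rule r(1))
    show "snd ?b ` fst ?b = ball 0 r" using bx by (force simp: image_image)
    show "\<phi> t (chart_inv ?b x) = chart_inv ?b (x + t *\<^sub>R axis ?L 1)"
      if x: "x \<in> ?B" "x + t *\<^sub>R axis ?L 1 \<in> ?B" for x t
    proof -
      have "chart_inv c (proj x + y0) \<in> topspace (Top M)"
        using chart_inv_in[OF Gq(2)] chart_domain_subset[OF cc] x(1) BW by blast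
      moreover have "proj (x + t *\<^sub>R axis ?L 1) = proj x"
        by (simp add: proj_def algebra_simps)
      ultimately show ?thesis
        using x BW by (simp add: binv[OF x(1)] binv[OF x(2)] Gc subset_iff flow_add[OF flow] add.commute)
    qed
    show "snd ?b p $ ?L = 0" if p: "p \<in> fst ?b \<inter> S" for p
    proof -
      obtain x where x: "x \<in> ?B" "p = chart_inv c (G x)" using p by auto
      have "p \<in> fst c" unfolding x(2) using chart_inv_in[OF Grange] BW x(1) by blast
      then have "snd c p \<in> snd c ` (fst c \<inter> S)" using p by auto
      then have L: "G x $ ?L = 0" unfolding slice using cG[OF x(1)] x(2) by simp
      have z: "G x - y0 \<in> W" using r(2) x(1) by auto
      have "G (G x - y0) = G x"
        using G0[of "G x - y0"] L y0 Grange BW x(1) by auto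
      then have "G x - y0 = x" using gG[OF z] gG[of x] x(1) BW by auto
      then have "x $ ?L = (G x - y0) $ ?L" by simp
      then have "x $ ?L = 0" using L y0 by simp
      then show ?thesis using bx[OF x(1)] x(2) by simp
    qed
  qed
qed

section \<open>Forms preserved by translations\<close>

text \<open>A map that is a translation in the chart \<open>b\<close> leaves the coordinates of tangent vectors with
  respect to \<open>b\<close> unchanged.  The definition of the differential picks an unknown auxiliary
  chart \<open>c\<close>; passing from \<open>b\<close> to \<open>c\<close> and back has no effect by the chain rule.\<close>

lemma differential_chart_translation:
  assumes M: "smooth_manifold M" and b: "b \<in> charts_at M p"
    and W: "open W" "snd b p \<in> W" "W \<subseteq> snd b ` fst b"
    and tr: "\<And>x. x \<in> W \<Longrightarrow> x + w \<in> snd b ` fst b \<and> F (chart_inv b x) = chart_inv b (x + w)"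
  shows "differential M F p (chart_inv_diff M b (snd b p) u) = chart_inv_diff M b (snd b p + w) u"
proof -
  note b' = charts_atD(1)[OF b] and pb = charts_atD(2)[OF b]
  note bb = smooth_chart_is_chart[OF b']
  define c where "c = (SOME c. c \<in> charts_at M p)"
  have c: "c \<in> charts_at M p" unfolding c_def using b by (rule someI)
  note c' = charts_atD(1)[OF c] and pc = charts_atD(2)[OF c]
  note cc = smooth_chart_is_chart[OF c']
  let ?q = "F p" and ?D = "\<lambda>c d p. frechet_derivative (transition c d) (at (snd c p))"
  have q: "?q = chart_inv b (snd b p + w)"
    using tr[OF W(2)] chart_inv_left[OF bb pb] by simp
  have "snd b p + w \<in> snd b ` fst b" using tr[OF W(2)] by blast
  from chart_inv_in[OF this] chart_inv_right[OF this]
  have qb: "?q \<in> fst b" "snd b ?q = snd b p + w" unfolding q by simp_all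
  have bq: "b \<in> charts_at M ?q" using b' qb by (simp add: charts_at_def)
  have "frechet_derivative (snd d \<circ> F \<circ> chart_inv c) (at (snd c p)) (?D b c p u) = ?D b d ?q u"
    if d: "d \<in> charts_at M ?q" for d
  proof -
    have 1: "(transition c b has_derivative ?D c b p) (at (snd c p))"
      by (rule transition_has_derivative[OF M c b])
    have "(transition b d has_derivative ?D b d ?q) (at (snd b p + w))"
      using transition_has_derivative[OF M bq d] qb(2) by simp
    moreover have "((\<lambda>y. transition c b y + w) has_derivative ?D c b p) (at (snd c p))"
      using has_derivative_add[OF 1 has_derivative_const] by simp
    ultimately have 2: "((\<lambda>y. transition b d (transition c b y + w)) has_derivative
        (\<lambda>u. ?D b d ?q (?D c b p u))) (at (snd c p))"
      using has_derivative_compose[of "\<lambda>y. transition c b y + w" "?D c b p" "snd c p" UNIV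
          "transition b d" "?D b d ?q"] transition_chart[OF cc pc, of b] by simp
    let ?V = "snd c ` (fst c \<inter> {z \<in> fst b. snd b z \<in> W})"
    have V: "open ?V" by (rule open_chart_image[OF cc openin_chart_vimage[OF bb W(1)]])
    have pV: "snd c p \<in> ?V" using pc pb W(2) by blast
    have eq: "transition b d (transition c b y + w) = (snd d \<circ> F \<circ> chart_inv c) y" if y: "y \<in> ?V" for y
    proof -
      obtain z where z: "z \<in> fst c" "z \<in> fst b" "snd b z \<in> W" "y = snd c z"
        using y by blast
      have "F z = chart_inv b (snd b z + w)"
        using tr[OF z(3)] chart_inv_left[OF bb z(2)] by simp
      moreover have "transition c b y = snd b z" "chart_inv c y = z"
        using transition_chart[OF cc z(1)] chart_inv_left[OF cc z(1)] z(4) by simp_all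
      ultimately show ?thesis by (simp add: transition_def)
    qed
    have "((snd d \<circ> F \<circ> chart_inv c) has_derivative (\<lambda>u. ?D b d ?q (?D c b p u))) (at (snd c p))"
      by (rule has_derivative_transform_within_open[OF 2 V pV eq])
    moreover have "?D c b p (?D b c p u) = u"
      using transition_derivative_compose[OF M b c b, of u] transition_derivative_self[OF b] by simp
    ultimately show ?thesis by (simp add: frechet_derivative_at[symmetric])
  qed
  moreover have "chart_inv_diff M b (snd b p) u c = ?D b c p u"
    using c by (simp add: chart_inv_diff_eq[OF b])
  ultimately show ?thesis
    unfolding differential_def Let_def c_def[symmetric] qb(2)[symmetric] chart_inv_diff_eq[OF bq]
    by auto
qed

text \<open>Hence a form preserved by such a map has coefficients invariant under the translation.\<close>

lemma push_form_translation_invariant: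
  assumes M: "smooth_manifold M" and b: "b \<in> smooth_charts M" and F: "preserves_form M F \<omega>"
    and W: "open W" "x \<in> W" "W \<subseteq> snd b ` fst b"
    and tr: "\<And>x. x \<in> W \<Longrightarrow> x + w \<in> snd b ` fst b \<and> F (chart_inv b x) = chart_inv b (x + w)"
  shows "push_form M b \<omega> (x + w) u = push_form M b \<omega> x u"
proof -
  define p where "p = chart_inv b x"
  have x: "x \<in> snd b ` fst b" using W by blast
  have p: "p \<in> fst b" "snd b p = x"
    unfolding p_def using chart_inv_in[OF x] chart_inv_right[OF x] by auto
  have bp: "b \<in> charts_at M p" using b p by (simp add: charts_at_def)
  have "p \<in> topspace (Top M)" using p(1) chart_domain_subset[OF smooth_chart_is_chart[OF b]] by auto
  then have "\<omega> (F p) (\<lambda>i. differential M F p (chart_inv_diff M b x (u i))) =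
      \<omega> p (\<lambda>i. chart_inv_diff M b x (u i))"
    using F chart_inv_diff_tangent[OF M bp] p(2) unfolding preserves_form_def by simp
  moreover have "differential M F p (chart_inv_diff M b x u) = chart_inv_diff M b (x + w) u" for u
    using differential_chart_translation[OF M bp W(1) _ W(3) tr] p(2) W(2) by simp
  ultimately show ?thesis
    using tr[OF W(2)] by (simp add: push_form_def p_def)
qed

section \<open>Normalising the volume form\<close>

text \<open>In the flow box the density \<open>\<rho>\<close> of the volume form does not depend on the flow direction \<open>l\<close>.
  Replace another coordinate \<open>x\<^sub>k\<close> by the primitive \<open>h\<close> of \<open>\<rho>\<close> in the direction \<open>k\<close>.  The
  Jacobian determinant of this change is the derivative of \<open>h\<close> along \<open>k\<close>, which is \<open>\<rho>\<close>, so
  the new density is \<open>1\<close>.  Like \<open>\<rho>\<close>, the primitive does not depend on \<open>x\<^sub>l\<close>, so translations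
  along \<open>l\<close> remain translations and the field is still constant.\<close>

lemma straightened_chart_volume:
  fixes M :: "('a, 'n::finite) manifold"
  assumes M: "smooth_manifold M" and vol: "volume_form M \<omega>"
    and flow: "flow_of M X \<phi>" and pres: "\<And>t. preserves_form M (\<phi> t) \<omega>"
    and b: "b \<in> charts_at M a" "snd b a = 0" and range: "snd b ` fst b = ball 0 r"
    and box: "\<And>x t. x \<in> ball 0 r \<Longrightarrow> x + t *\<^sub>R axis l 1 \<in> ball 0 r \<Longrightarrow>
      \<phi> t (chart_inv b x) = chart_inv b (x + t *\<^sub>R axis l 1)"
    and kl: "k \<noteq> l"
  obtains U f where "(U, f \<circ> snd b) \<in> charts_at M a" "f 0 = 0" "U \<subseteq> fst b" "\<And>x. f x $ l = x $ l"
    "\<And>p. p \<in> U \<Longrightarrow> X p (U, f \<circ> snd b) = axis l 1"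
    "\<And>p u. p \<in> U \<Longrightarrow> push_form M (U, f \<circ> snd b) \<omega> (f (snd b p)) u = std_volume u"
proof -
  let ?B = "ball 0 r :: (real, 'n) vec set"
  note b' = charts_atD(1)[OF b(1)]
  note bb = smooth_chart_is_chart[OF b']
  define \<rho> where "\<rho> x = push_form M b \<omega> x (\<lambda>i. axis i 1)" for x
  have \<rho>_smooth: "smooth_on ?B \<rho>"
    using vol b' unfolding \<rho>_def[abs_def] volume_form_def range[symmetric] by blast
  have \<rho>_inv: "\<rho> (x + t *\<^sub>R axis l 1) = \<rho> x" if "x \<in> ?B" "x + t *\<^sub>R axis l 1 \<in> ?B" for x t
    unfolding \<rho>_def
  proof (rule push_form_translation_invariant[OF M b' pres[of t]])
    have "open ((\<lambda>x. x + t *\<^sub>R axis l 1) -` ?B)"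
      by (intro open_vimage continuous_intros open_ball)
    then show "open (?B \<inter> (\<lambda>x. x + t *\<^sub>R axis l 1) -` ?B)" by (intro open_Int open_ball)
  qed (use that box range in auto)
  have \<rho>_nz: "\<rho> (snd b p) \<noteq> 0" if "p \<in> fst b" for p
    unfolding \<rho>_def using that b' by (intro push_form_basis_nonzero[OF M _ vol]) (simp add: charts_at_def)
  define h where "h = coord_primitive k \<rho>"
  have h_smooth: "smooth_on ?B h" unfolding h_def by (rule smooth_coord_primitive[OF \<rho>_smooth])
  have h_inv: "h (x + t *\<^sub>R axis l 1) = h x" if x: "x \<in> ?B" "x + t *\<^sub>R axis l 1 \<in> ?B" for x t
  proof -
    have eq: "\<rho> (scale_coord k s (x + t *\<^sub>R axis l 1)) = \<rho> (scale_coord k s x)" if s: "s \<in> {0..1}" for s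
    proof -
      have "scale_coord k s (x + t *\<^sub>R axis l 1) = scale_coord k s x + t *\<^sub>R axis l 1"
        using kl by (simp add: vec_eq_iff scale_coord_component axis_def)
      then show ?thesis
        using \<rho>_inv[OF scale_coord_ball[OF x(1) s, of k], of t] scale_coord_ball[OF x(2) s, of k] by simp
    qed
    have "integral {0..1} (\<lambda>s. \<rho> (scale_coord k s (x + t *\<^sub>R axis l 1))) =
        integral {0..1} (\<lambda>s. \<rho> (scale_coord k s x))"
      by (rule integral_cong) (rule eq)
    then show ?thesis using kl by (simp add: h_def coord_primitive_def axis_def)
  qed
  define f where "f x = x + (h x - x $ k) *\<^sub>R axis k 1" for x
  let ?d = "\<lambda>x. frechet_derivative h (at x)" and ?D = "\<lambda>x. frechet_derivative f (at x)"
  have f_comp: "f x $ i = (if i = k then h x else x $ i)" for x i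
    by (simp add: f_def axis_def)
  have f_smooth: "smooth_on ?B f"
    unfolding smooth_on_def
  proof
    fix m
    have "ck_on m ?B (\<lambda>x. if i = k then h x else x $ i)" for i
      using h_smooth ck_on_bounded_linear[OF bounded_linear_vec_nth]
      by (cases "i = k") (simp_all add: smooth_on_def)
    then show "ck_on m ?B f"
      unfolding ck_on_vec_iff[OF open_ball] f_comp by blast
  qed
  have f_inv: "f (x + t *\<^sub>R axis l 1) = f x + t *\<^sub>R axis l 1"
    if "x \<in> ?B" "x + t *\<^sub>R axis l 1 \<in> ?B" for x t
    using h_inv[OF that] kl by (simp add: vec_eq_iff f_comp axis_def)
  have f0: "f 0 = 0" by (simp add: vec_eq_iff f_comp h_def coord_primitive_def)
  have df: "?D x v $ i = (if i = k then ?d x v else v $ i)" if "x \<in> ?B" for x v i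
  proof -
    have "(f has_derivative (\<lambda>v. v + (?d x v - v $ k) *\<^sub>R axis k 1)) (at x)"
      unfolding f_def
      by (auto intro!: derivative_eq_intros smooth_on_derivative[OF h_smooth that]
          bounded_linear_imp_has_derivative bounded_linear_vec_nth)
    then show ?thesis by (simp add: frechet_derivative_at[symmetric] axis_def)
  qed
  have dk: "?d x (axis k 1) = \<rho> x" if "x \<in> ?B" for x
    unfolding h_def by (rule coord_primitive_derivative[OF \<rho>_smooth that])
  have "0 \<in> snd b ` fst b" using b(2) charts_atD(2)[OF b(1)] by (metis image_eqI)
  then have 0: "0 \<in> ?B" using range by simp
  \<comment> \<open>The derivative fixes all coordinates but \<open>k\<close>, where the diagonal entry is \<open>\<rho> 0\<close>.\<close>
  have inj: "v = 0" if v: "?D 0 v = 0" for v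
  proof -
    have i: "v $ i = 0" if "i \<noteq> k" for i using df[OF 0, of v i] v that by simp
    then have "v = v $ k *\<^sub>R axis k 1" by (auto simp: vec_eq_iff axis_def)
    moreover have "linear (?d 0)"
      using smooth_on_derivative[OF h_smooth 0] has_derivative_linear by blast
    ultimately have "?d 0 v = v $ k *\<^sub>R ?d 0 (axis k 1)" by (metis linear_cmul)
    then have "v $ k * \<rho> 0 = 0" using df[OF 0, of v k] v dk[OF 0] by simp
    then have "v $ k = 0" using \<rho>_nz[OF charts_atD(2)[OF b(1)]] b(2) by simp
    then show "v = 0" using i by (metis vec_eq_iff zero_index)
  qed
  obtain W g where W: "open W" "W \<subseteq> ?B" "0 \<in> W" "open (f ` W)" "smooth_on (f ` W) g"
    and g: "\<And>x. x \<in> W \<Longrightarrow> g (f x) = x"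
    using smooth_inverse_function[OF open_ball f_smooth 0 inj] by blast
  define U where "U = chart_inv b ` W"
  let ?c = "(U, f \<circ> snd b)"
  have WB: "W \<subseteq> snd b ` fst b" using W(2) range by simp
  have c: "?c \<in> smooth_charts M"
    unfolding U_def
    by (rule chart_compose_diffeo[OF M b' W(1) WB smooth_on_subset[OF f_smooth W(2)] W(4,5) g])
  have U: "U = {p \<in> fst b. snd b p \<in> W}" unfolding U_def by (rule chart_inv_image[OF bb WB])
  have at: "?c \<in> charts_at M p" "b \<in> charts_at M p" "snd b p \<in> W" "snd b p \<in> ?B"
    if "p \<in> U" for p
    using c b' that W(2) by (auto simp: charts_at_def U)
  show thesis
  proof (rule that[of U f])
    show "?c \<in> charts_at M a"
      using c b charts_atD(2)[OF b(1)] W(3) by (simp add: charts_at_def U)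
    show "f 0 = 0" by (rule f0)
    show "U \<subseteq> fst b" by (auto simp: U)
    show "f x $ l = x $ l" for x using kl by (simp add: f_comp)
    show "X p ?c = axis l 1" if p: "p \<in> U" for p
    proof -
      let ?x = "snd b p" and ?e = "axis l 1 :: (real, 'n) vec"
      let ?T = "(\<lambda>s. ?x + s *\<^sub>R ?e) -` W"
      have T: "open ?T" by (intro open_vimage continuous_intros W(1))
      have "0 \<in> ?T" using at(3)[OF p] by simp
      have p_eq: "p = chart_inv b ?x" using p chart_inv_left[OF bb] by (simp add: U)
      have eq: "f ?x + s *\<^sub>R ?e = snd ?c (\<phi> s p)" if s: "s \<in> ?T" for s
      proof -
        have W': "?x + s *\<^sub>R ?e \<in> W" using s by simp
        have "\<phi> s p = chart_inv b (?x + s *\<^sub>R ?e)"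
          using box[OF at(4)[OF p], of s] W' W(2) p_eq by auto
        moreover have "snd b (chart_inv b (?x + s *\<^sub>R ?e)) = ?x + s *\<^sub>R ?e"
          by (rule chart_inv_right) (use WB W' in blast)
        ultimately show ?thesis
          using f_inv[OF at(4)[OF p], of s] W' W(2) by auto
      qed
      have "((\<lambda>s. f ?x + s *\<^sub>R ?e) has_vector_derivative ?e) (at 0)"
        by (auto intro!: derivative_eq_intros)
      from has_vector_derivative_transform_within_open[OF this T \<open>0 \<in> ?T\<close> eq]
      have "((\<lambda>s. snd ?c (\<phi> s p)) has_vector_derivative ?e) (at 0)" .
      then show ?thesis
        unfolding field_eq_flow_derivative[OF flow at(1)[OF p]] by (rule vector_derivative_at)
    qed
    show "push_form M ?c \<omega> (f (snd b p)) u = std_volume u" if p: "p \<in> U" for p u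
    proof -
      let ?x = "snd b p"
      have alt: "alternating_form_at M p (\<omega> p)"
        using vol at(1)[OF p] chart_domain_subset[OF smooth_chart_is_chart[OF c]] p
        by (auto simp: volume_form_def)
      have std: "push_form M ?c \<omega> (f ?x) u = std_volume u * push_form M ?c \<omega> (f ?x) (\<lambda>i. axis i 1)" for u
        using push_form_eq_std_volume[where \<omega> = \<omega>, OF M at(1)[OF p] alt, of u]
        by (simp only: snd_conv o_apply)
      have f_trans: "f x = transition b ?c x" if x: "x \<in> W" for x
        using chart_inv_right[of x b] WB x by (auto simp: transition_def)
      have "(f has_derivative ?D ?x) (at ?x)" by (rule smooth_on_derivative[OF f_smooth at(4)[OF p]])
      then have "(transition b ?c has_derivative ?D ?x) (at ?x)"
        by (rule has_derivative_transform_within_open[OF _ W(1) at(3)[OF p] f_trans])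
      then have "frechet_derivative (transition b ?c) (at ?x) = ?D ?x"
        by (rule frechet_derivative_at[symmetric])
      then have "\<rho> ?x = push_form M ?c \<omega> (f ?x) (\<lambda>i. ?D ?x (axis i 1))"
        unfolding \<rho>_def using push_form_change[OF M at(2)[OF p] at(1)[OF p]] by simp
      also have "\<dots> = std_volume (\<lambda>i. ?D ?x (axis i 1)) * push_form M ?c \<omega> (f ?x) (\<lambda>i. axis i 1)"
        by (rule std)
      also have "std_volume (\<lambda>i. ?D ?x (axis i 1)) = \<rho> ?x"
      proof -
        have "(\<chi> i j. ?D ?x (axis j 1) $ i) =
            (\<chi> i j. if i = k then (\<chi> j. ?d ?x (axis j 1)) $ j else (mat 1 :: real ^ 'n ^ 'n) $ i $ j)"
          using df[OF at(4)[OF p]] by (auto simp: vec_eq_iff mat_def axis_def)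
        then show ?thesis
          unfolding std_volume_def using det_replace_row_of_identity[of k] dk[OF at(4)[OF p]] by simp
      qed
      finally have "push_form M ?c \<omega> (f ?x) (\<lambda>i. axis i 1) = 1"
        using \<rho>_nz[OF charts_atD(2)[OF at(2)[OF p]]] by (simp only: mult_cancel_left1) simp
      then show ?thesis unfolding std[of u] by simp
    qed
  qed
qed

theorem lemma3p1:
  fixes M :: "('a, 'n::{finite, linorder}) manifold"
    and \<omega> :: "('a, 'n) top_form"
    and X :: "'a \<Rightarrow> ('a, 'n) tangent"
    and a :: 'a
    and \<Sigma> :: "'a set"
  assumes "smooth_manifold M"
    and "compact_space (Top M)"
    and "CARD('n) \<ge> 3"
    and "volume_form M \<omega>"
    and "X \<in> volume_preserving_fields M \<omega>"
    and "regular_point M X a"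
    and "transversal_section M X \<Sigma>"
    and "a \<in> \<Sigma>"
  shows "\<exists>U \<alpha>. (U, \<alpha>) \<in> smooth_charts M \<and> a \<in> U \<and> \<alpha> a = 0 \<and>
    (\<forall>y\<in>\<alpha> ` U. push_field (U, \<alpha>) X y = axis last_index 1) \<and>
    (\<forall>y\<in>\<alpha> ` U. \<forall>u. push_form M (U, \<alpha>) \<omega> y u = std_volume u) \<and>
    \<alpha> ` (U \<inter> \<Sigma>) \<subseteq> {y. y $ last_index = 0}"
proof -
  obtain \<phi> where flow: "flow_of M X \<phi>" and pres: "\<And>t. preserves_form M (\<phi> t) \<omega>"
    using assms(5) unfolding volume_preserving_fields_def by blast
  have "\<not> (UNIV :: 'n set) \<subseteq> {last_index}"
    using card_mono[of "{last_index :: 'n}" UNIV] assms(3) by auto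
  then obtain k :: 'n where k: "k \<noteq> last_index" by auto
  show ?thesis
  proof (rule transversal_flow_box[OF assms(1) flow assms(7,8)])
    fix b r
    assume b: "b \<in> charts_at M a" "snd b a = 0" "r > 0" "snd b ` fst b = ball 0 r"
      and box: "\<And>x t. x \<in> ball 0 r \<Longrightarrow> x + t *\<^sub>R axis last_index 1 \<in> ball 0 r \<Longrightarrow>
        \<phi> t (chart_inv b x) = chart_inv b (x + t *\<^sub>R axis last_index 1)"
      and sect: "\<And>p. p \<in> fst b \<inter> \<Sigma> \<Longrightarrow> snd b p $ last_index = 0"
    show ?thesis
    proof (rule straightened_chart_volume[OF assms(1,4) flow pres b(1,2,4) box k])
      fix U f
      assume c: "(U, f \<circ> snd b) \<in> charts_at M a" and f: "f 0 = 0" "U \<subseteq> fst b"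
          "\<And>x. f x $ last_index = x $ last_index"
        and field: "\<And>p. p \<in> U \<Longrightarrow> X p (U, f \<circ> snd b) = axis last_index 1"
        and form: "\<And>p u. p \<in> U \<Longrightarrow> push_form M (U, f \<circ> snd b) \<omega> (f (snd b p)) u = std_volume u"
      have left: "chart_inv (U, f \<circ> snd b) (f (snd b p)) = p" if "p \<in> U" for p
        using chart_inv_left[OF smooth_chart_is_chart[OF charts_atD(1)[OF c]]] that by simp
      show ?thesis
      proof (intro exI[of _ U] exI[of _ "f \<circ> snd b"] conjI)
        show "(U, f \<circ> snd b) \<in> smooth_charts M" "a \<in> U" using charts_atD[OF c] by simp_all
        show "(f \<circ> snd b) a = 0" using b(2) f(1) by simp
        show "\<forall>y\<in>(f \<circ> snd b) ` U. push_field (U, f \<circ> snd b) X y = axis last_index 1"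
          using left field by (simp add: push_field_def)
        show "\<forall>y\<in>(f \<circ> snd b) ` U. \<forall>u. push_form M (U, f \<circ> snd b) \<omega> y u = std_volume u"
          using form by simp
        show "(f \<circ> snd b) ` (U \<inter> \<Sigma>) \<subseteq> {y. y $ last_index = 0}"
          using sect f(2,3) by auto
      qed
    qed
  qed
qed

end
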